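(* Let $q\in L^1_{\mathrm{loc}}(\mathbb R)$ and let $N(q)=i\begin{pmatrix}\frac{d}{dx}&-q\\\overline q&\frac{d}{dx}\end{pmatrix}$ with maximal operator $\widetilde D_{\max}(q)$ in $L^2(\mathbb R)^2$ (defined by $F\mapsto N(q)F$ on $\{F\in L^2(\mathbb R)^2\cap AC_{\mathrm{loc}}(\mathbb R)^2: N(q)F\in L^2(\mathbb R)^2\}$). Then: (i) As differential expressions, $M(-q)M(q)=N(q)^2$. (ii) Let $U_q$ be the $2\times2$ matrix solution of $U_q'=\begin{pmatrix}0&q\\-\overline q&0\end{pmatrix}U_q$, $U_q(0)=I_2$. Then $U_q(x)$ is unitary for every $x\in\mathbb R$, its entries lie in $AC_{\mathrm{loc}}(\mathbb R)\cap L^\infty(\mathbb R)$, and $U_q^{-1}N(q)U_q=i\frac{d}{dx}I_2$. (iii) With $\mathcal U_q$ the operator of multiplication by $U_q(\cdot)$ on $L^2(\mathbb R)^2$, $\mathcal U_q^{-1}\widetilde D_{\max}(q)\mathcal U_q=\big(i\frac{d}{dx}I_2\big)_{\max}$ with domain $H^{1,2}(\mathbb R)^2=\{F\in L^2\cap AC_{\mathrm{loc}}: F'\in L^2\}$, and $\mathcal U_q^{-1}D_{\max}(-q)D_{\max}(q)\mathcal U_q=\big(-\frac{d^2}{dx^2}I_2\big)_{\max}$ with domain $H^{2,2}(\mathbb R)^2=\{F\in L^2(\mathbb R)^2: F,F'\in AC_{\mathrm{loc}}(\mathbb R)^2,\ F',F''\in L^2(\mathbb R)^2\}$.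
   Context: $M(q)=i\begin{pmatrix}\frac{d}{dx}&-q\\-\overline q&-\frac{d}{dx}\end{pmatrix}$ and $D_{\max}(q)F=M(q)F$ on $\{F\in L^2(\mathbb R)^2: F\in AC_{\mathrm{loc}}(\mathbb R)^2,\ M(q)F\in L^2(\mathbb R)^2\}$. *)

theory Defs
  imports "HOL-Analysis.Analysis"
begin

definition absolutely_continuous_on :: "real set \<Rightarrow> (real \<Rightarrow> 'a::real_normed_vector) \<Rightarrow> bool" where
  "absolutely_continuous_on S f \<longleftrightarrow>
     (\<forall>\<epsilon>>0. \<exists>\<delta>>0. \<forall>(n::nat) (a::nat \<Rightarrow> real) b.
        (\<forall>k<n. a k \<le> b k \<and> {a k..b k} \<subseteq> S) \<and>
        (\<forall>i<n. \<forall>j<n. i \<noteq> j \<longrightarrow> {a i<..<b i} \<inter> {a j<..<b j} = {}) \<and>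
        (\<Sum>k<n. b k - a k) < \<delta>
        \<longrightarrow> (\<Sum>k<n. norm (f (b k) - f (a k))) < \<epsilon>)"

definition AC_loc :: "(real \<Rightarrow> 'a::real_normed_vector) \<Rightarrow> bool" where
  "AC_loc f \<longleftrightarrow> (\<forall>a b. absolutely_continuous_on {a..b} f)"

definition L1_loc :: "(real \<Rightarrow> 'a::{banach,second_countable_topology}) \<Rightarrow> bool" where
  "L1_loc f \<longleftrightarrow> (\<forall>a b. set_integrable lebesgue {a..b} f)"

definition L2 :: "(real \<Rightarrow> 'a::real_normed_vector) \<Rightarrow> bool" where
  "L2 f \<longleftrightarrow> f \<in> borel_measurable lebesgue \<and> integrable lebesgue (\<lambda>x. (norm (f x))\<^sup>2)"

definition Linf :: "(real \<Rightarrow> 'a::real_normed_vector) \<Rightarrow> bool" where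
  "Linf f \<longleftrightarrow> f \<in> borel_measurable lebesgue \<and> (\<exists>C. AE x in lebesgue. norm (f x) \<le> C)"

text \<open>Pointwise derivative (exists a.e. for AC_loc functions).\<close>
definition vd :: "(real \<Rightarrow> 'a::real_normed_vector) \<Rightarrow> real \<Rightarrow> 'a" where
  "vd f x = vector_derivative f (at x)"

definition Mexp :: "(real \<Rightarrow> complex) \<Rightarrow> (real \<Rightarrow> complex^2) \<Rightarrow> real \<Rightarrow> complex^2" where
  "Mexp q F x = \<i> *s vector [vd (\<lambda>t. F t $ 1) x - q x * F x $ 2,
                             - cnj (q x) * F x $ 1 - vd (\<lambda>t. F t $ 2) x]"

definition Nexp :: "(real \<Rightarrow> complex) \<Rightarrow> (real \<Rightarrow> complex^2) \<Rightarrow> real \<Rightarrow> complex^2" where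
  "Nexp q F x = \<i> *s vector [vd (\<lambda>t. F t $ 1) x - q x * F x $ 2,
                             cnj (q x) * F x $ 1 + vd (\<lambda>t. F t $ 2) x]"

section \<open>Operators in L^2(R)^2, as graphs (relations on representatives, closed under a.e. equality)\<close>

definition maxop :: "((real \<Rightarrow> complex^2) \<Rightarrow> real \<Rightarrow> complex^2)
                     \<Rightarrow> ((real \<Rightarrow> complex^2) \<times> (real \<Rightarrow> complex^2)) set" where
  "maxop E = {(F, G). L2 F \<and> L2 G \<and>
      (\<exists>F0. AC_loc F0 \<and> (AE x in lebesgue. F0 x = F x) \<and> (AE x in lebesgue. G x = E F0 x))}"

definition maxop_neg_dd :: "((real \<Rightarrow> complex^2) \<times> (real \<Rightarrow> complex^2)) set" where
  "maxop_neg_dd = {(F, G). L2 F \<and> L2 G \<and>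
      (\<exists>F0 F1. AC_loc F0 \<and> AC_loc F1 \<and> (AE x in lebesgue. F0 x = F x) \<and>
               (AE x in lebesgue. vd F0 x = F1 x) \<and> (AE x in lebesgue. G x = - vd F1 x))}"

definition Dmax :: "(real \<Rightarrow> complex) \<Rightarrow> ((real \<Rightarrow> complex^2) \<times> (real \<Rightarrow> complex^2)) set" where
  "Dmax q = maxop (Mexp q)"

definition Dtilde_max :: "(real \<Rightarrow> complex) \<Rightarrow> ((real \<Rightarrow> complex^2) \<times> (real \<Rightarrow> complex^2)) set" where
  "Dtilde_max q = maxop (Nexp q)"

definition iD :: "(real \<Rightarrow> complex^2) \<Rightarrow> real \<Rightarrow> complex^2" where
  "iD F x = \<i> *s vd F x"

definition op_prod :: "('a \<times> 'a) set \<Rightarrow> ('a \<times> 'a) set \<Rightarrow> ('a \<times> 'a) set" where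
  "op_prod A B = {(F, H). \<exists>G. (F, G) \<in> B \<and> (G, H) \<in> A}"

text \<open>Conjugation U^{-1} A U by the multiplication operator by U(.):
  (U^{-1} A U) F = G  iff  A (U F) = U G.\<close>
definition conj_mult :: "(real \<Rightarrow> complex^2^2) \<Rightarrow> ((real \<Rightarrow> complex^2) \<times> (real \<Rightarrow> complex^2)) set
                          \<Rightarrow> ((real \<Rightarrow> complex^2) \<times> (real \<Rightarrow> complex^2)) set" where
  "conj_mult U A = {(F, G). ((\<lambda>x. U x *v F x), (\<lambda>x. U x *v G x)) \<in> A}"

definition dom_op :: "('a \<times> 'b) set \<Rightarrow> 'a set" where
  "dom_op A = fst ` A"

definition H12 :: "(real \<Rightarrow> complex^2) set" where
  "H12 = {F. L2 F \<and> (\<exists>F0. AC_loc F0 \<and> (AE x in lebesgue. F0 x = F x) \<and> L2 (vd F0))}"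

definition H22 :: "(real \<Rightarrow> complex^2) set" where
  "H22 = {F. L2 F \<and> (\<exists>F0 F1. AC_loc F0 \<and> AC_loc F1 \<and> (AE x in lebesgue. F0 x = F x) \<and>
              (AE x in lebesgue. vd F0 x = F1 x) \<and> L2 F1 \<and> L2 (vd F1))}"

definition adjoint_mat :: "complex^2^2 \<Rightarrow> complex^2^2" where
  "adjoint_mat A = (\<chi> i j. cnj (A $ j $ i))"

definition unitary_mat :: "complex^2^2 \<Rightarrow> bool" where
  "unitary_mat A \<longleftrightarrow> A ** adjoint_mat A = mat 1 \<and> adjoint_mat A ** A = mat 1"

definition coeff_mat :: "(real \<Rightarrow> complex) \<Rightarrow> real \<Rightarrow> complex^2^2" where
  "coeff_mat q x = vector [vector [0, q x], vector [- cnj (q x), 0]]"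

definition is_Uq :: "(real \<Rightarrow> complex) \<Rightarrow> (real \<Rightarrow> complex^2^2) \<Rightarrow> bool" where
  "is_Uq q U \<longleftrightarrow> AC_loc U \<and> U 0 = mat 1 \<and>
     (AE x in lebesgue. (U has_vector_derivative (coeff_mat q x ** U x)) (at x))"

end

theory Submission
  imports Defs
begin

text \<open>Writing \<open>\<sigma> = diag(1, -1)\<close>, one has \<open>M(q) = \<sigma> N(q)\<close> and \<open>M(-q) \<sigma> = N(q)\<close>, whence \<open>M(-q) M(q) = N(q)\<^sup>2\<close>.
  Since \<open>N(q) F = i (F' - A F)\<close> with the skew-Hermitian matrix \<open>A\<close> of the system for \<open>U\<close>, the product
  rule gives \<open>N(q) (U F) = i U F'\<close>, and \<open>U\<^sup>* U\<close> is constant because its derivative vanishes; so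
  multiplication by \<open>U\<close> is an isometry which carries \<open>i d/dx\<close> to \<open>N(q)\<close> and \<open>-d\<^sup>2/dx\<^sup>2\<close> to \<open>M(-q) M(q)\<close>.
  The analysis behind this is that an absolutely continuous function is differentiable almost
  everywhere and is the integral of its derivative: on short intervals it is the difference of two
  monotone functions (its variation and the rest), whose Stieltjes measures have densities by the
  Radon-Nikodym theorem. For the second-order operator one also needs that \<open>F, F'' \<in> L\<^sup>2\<close> implies
  \<open>F' \<in> L\<^sup>2\<close>, since the intermediate function \<open>M(q) U F\<close> has to lie in \<open>L\<^sup>2\<close>.\<close>

section \<open>Absolutely continuous functions\<close>

text \<open>Why short intervals: the clause of absolute continuity with \<epsilon> = 1 bounds every
  partition sum on an interval shorter than \<delta> by 1, so the variation is finite there without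
  counting subdivisions. The function is then frozen outside the interval, which makes variation,
  Stieltjes measure and density global objects on the line. Densities found on different intervals
  are unrelated as functions, but each agrees a.e. with the pointwise derivative
  \<open>vd f\<close>, and this single integrand is what allows the local formulas to be glued. A
  second obstacle is that the operators are relations on representatives, closed under a.e.
  equality, while \<open>Mexp\<close> and \<open>Nexp\<close> differentiate. Each direction of a
  graph identity must therefore exhibit an absolutely continuous representative. Multiplication by U
  or by its adjoint carries such representatives back and forth, which is why products of absolutely
  continuous functions are treated first.\<close>

definition interval_family :: "real set \<Rightarrow> nat \<Rightarrow> (nat \<Rightarrow> real) \<Rightarrow> (nat \<Rightarrow> real) \<Rightarrow> bool" where
  "interval_family S n a b \<longleftrightarrow> (\<forall>k<n. a k \<le> b k \<and> {a k..b k} \<subseteq> S) \<and>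
     (\<forall>i<n. \<forall>j<n. i \<noteq> j \<longrightarrow> {a i<..<b i} \<inter> {a j<..<b j} = {})"

lemma absolutely_continuous_on_iff:
  "absolutely_continuous_on S f \<longleftrightarrow> (\<forall>\<epsilon>>0. \<exists>\<delta>>0. \<forall>n a b. interval_family S n a b \<longrightarrow>
     (\<Sum>k<n. b k - a k) < \<delta> \<longrightarrow> (\<Sum>k<n. norm (f (b k) - f (a k))) < \<epsilon>)"
  unfolding absolutely_continuous_on_def interval_family_def by (simp only: imp_conjL)

lemma absolutely_continuous_onE:
  assumes "absolutely_continuous_on S f" "\<epsilon> > 0"
  obtains \<delta> where "\<delta> > 0" "\<And>n a b. interval_family S n a b \<Longrightarrow> (\<Sum>k<n. b k - a k) < \<delta> \<Longrightarrow>
    (\<Sum>k<n. norm (f (b k) - f (a k))) < \<epsilon>"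
  using assms unfolding absolutely_continuous_on_iff by blast

lemma absolutely_continuous_onI:
  assumes "\<And>\<epsilon>. \<epsilon> > 0 \<Longrightarrow> \<exists>\<delta>>0. \<forall>n a b. interval_family S n a b \<longrightarrow>
     (\<Sum>k<n. b k - a k) < \<delta> \<longrightarrow> (\<Sum>k<n. norm (f (b k) - f (a k))) < \<epsilon>"
  shows "absolutely_continuous_on S f"
  using assms unfolding absolutely_continuous_on_iff by blast

text \<open>The definition numbers its intervals by an initial segment of the naturals. Below,
  families are indexed by a set of intervals (the cover of a null set) and by pairs (interval, cell
  of its partition); enumerating the finite index set transfers the estimate.\<close>

lemma absolutely_continuous_on_finite_family:
  fixes f :: "real \<Rightarrow> 'a::real_normed_vector"
  assumes "absolutely_continuous_on S f" "\<epsilon> > 0"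
  obtains \<delta> where "\<delta> > 0"
    "\<And>(I::'i set) a b. finite I \<Longrightarrow> (\<And>i. i \<in> I \<Longrightarrow> a i \<le> b i \<and> {a i..b i} \<subseteq> S) \<Longrightarrow>
       (\<And>i j. i \<in> I \<Longrightarrow> j \<in> I \<Longrightarrow> i \<noteq> j \<Longrightarrow> {a i<..<b i} \<inter> {a j<..<b j} = {}) \<Longrightarrow>
       (\<Sum>i\<in>I. b i - a i) < \<delta> \<Longrightarrow> (\<Sum>i\<in>I. norm (f (b i) - f (a i))) < \<epsilon>"
proof -
  obtain \<delta> where "\<delta> > 0" and \<delta>: "\<And>n a b. interval_family S n a b \<Longrightarrow>
      (\<Sum>k<n. b k - a k) < \<delta> \<Longrightarrow> (\<Sum>k<n. norm (f (b k) - f (a k))) < \<epsilon>"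
    by (rule absolutely_continuous_onE[OF assms]) blast
  show thesis
  proof (rule that[OF \<open>\<delta> > 0\<close>])
    fix I :: "'i set" and a b
    assume I: "finite I" "\<And>i. i \<in> I \<Longrightarrow> a i \<le> b i \<and> {a i..b i} \<subseteq> S"
       "\<And>i j. i \<in> I \<Longrightarrow> j \<in> I \<Longrightarrow> i \<noteq> j \<Longrightarrow> {a i<..<b i} \<inter> {a j<..<b j} = {}"
       "(\<Sum>i\<in>I. b i - a i) < \<delta>"
    obtain h where h: "bij_betw h {..<card I} I"
      using ex_bij_betw_nat_finite[OF \<open>finite I\<close>] by (auto simp: atLeast0LessThan)
    have hI: "h k \<in> I" if "k < card I" for k
      using bij_betwE[OF h] that by auto
    have inj: "h i \<noteq> h j" if "i < card I" "j < card I" "i \<noteq> j" for i j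
      using h that by (auto simp: bij_betw_def inj_on_def)
    have s: "(\<Sum>k<card I. g (h k)) = sum g I" for g :: "'i \<Rightarrow> real"
      using sum.reindex_bij_betw[OF h, of g] .
    have "(\<Sum>k<card I. norm (f (b (h k)) - f (a (h k)))) < \<epsilon>"
    proof (rule \<delta>)
      show "interval_family S (card I) (\<lambda>k. a (h k)) (\<lambda>k. b (h k))"
        unfolding interval_family_def using I(2,3) hI inj by simp
      show "(\<Sum>k<card I. b (h k) - a (h k)) < \<delta>"
        using I(4) unfolding s[of "\<lambda>i. b i - a i"] .
    qed
    then show "(\<Sum>i\<in>I. norm (f (b i) - f (a i))) < \<epsilon>"
      unfolding s[of "\<lambda>i. norm (f (b i) - f (a i))"] .
  qed
qed

lemma interval_family_mono: "interval_family S n a b \<Longrightarrow> S \<subseteq> T \<Longrightarrow> interval_family T n a b"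
  unfolding interval_family_def by (meson order_trans)

lemma interval_familyD: "interval_family S n a b \<Longrightarrow> k < n \<Longrightarrow> a k \<le> b k \<and> {a k..b k} \<subseteq> S"
  unfolding interval_family_def by blast

lemma absolutely_continuous_on_subset:
  assumes f: "absolutely_continuous_on S f" and T: "T \<subseteq> S"
  shows "absolutely_continuous_on T f"
proof (rule absolutely_continuous_onI)
  fix \<epsilon> :: real assume "\<epsilon> > 0"
  from absolutely_continuous_onE[OF f this] obtain \<delta> where "\<delta> > 0"
    "\<And>n a b. interval_family S n a b \<Longrightarrow> (\<Sum>k<n. b k - a k) < \<delta> \<Longrightarrow>
      (\<Sum>k<n. norm (f (b k) - f (a k))) < \<epsilon>" by blast
  then show "\<exists>\<delta>>0. \<forall>n a b. interval_family T n a b \<longrightarrow>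
     (\<Sum>k<n. b k - a k) < \<delta> \<longrightarrow> (\<Sum>k<n. norm (f (b k) - f (a k))) < \<epsilon>"
    using interval_family_mono[OF _ T] by blast
qed

text \<open>Sums and products are handled through their increments: each of the two dominating
  functions receives half of \<epsilon>.\<close>

lemma absolutely_continuous_on_dominated2:
  assumes f: "absolutely_continuous_on S f" and g: "absolutely_continuous_on S g"
    and h: "\<And>x y. x \<le> y \<Longrightarrow> {x..y} \<subseteq> S \<Longrightarrow> norm (h y - h x) \<le> norm (f y - f x) + norm (g y - g x)"
  shows "absolutely_continuous_on S h"
proof (rule absolutely_continuous_onI)
  fix \<epsilon> :: real assume "\<epsilon> > 0"
  then have e2: "\<epsilon> / 2 > 0" by simp
  from absolutely_continuous_onE[OF f e2] obtain \<delta>1 where \<delta>1: "\<delta>1 > 0"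
    "\<And>n a b. interval_family S n a b \<Longrightarrow> (\<Sum>k<n. b k - a k) < \<delta>1 \<Longrightarrow>
      (\<Sum>k<n. norm (f (b k) - f (a k))) < \<epsilon> / 2" by blast
  from absolutely_continuous_onE[OF g e2] obtain \<delta>2 where \<delta>2: "\<delta>2 > 0"
    "\<And>n a b. interval_family S n a b \<Longrightarrow> (\<Sum>k<n. b k - a k) < \<delta>2 \<Longrightarrow>
      (\<Sum>k<n. norm (g (b k) - g (a k))) < \<epsilon> / 2" by blast
  show "\<exists>\<delta>>0. \<forall>n a b. interval_family S n a b \<longrightarrow>
     (\<Sum>k<n. b k - a k) < \<delta> \<longrightarrow> (\<Sum>k<n. norm (h (b k) - h (a k))) < \<epsilon>"
  proof (intro exI[of _ "min \<delta>1 \<delta>2"] conjI allI impI)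
    fix n a b assume *: "interval_family S n a b" "(\<Sum>k<n. b k - a k) < min \<delta>1 \<delta>2"
    have "(\<Sum>k<n. norm (h (b k) - h (a k))) \<le> (\<Sum>k<n. norm (f (b k) - f (a k)) + norm (g (b k) - g (a k)))"
      using h interval_familyD[OF *(1)] by (intro sum_mono) simp
    also have "\<dots> < \<epsilon> / 2 + \<epsilon> / 2"
      unfolding sum.distrib using * by (intro add_strict_mono \<delta>1(2) \<delta>2(2)) simp_all
    finally show "(\<Sum>k<n. norm (h (b k) - h (a k))) < \<epsilon>" by simp
  qed (use \<delta>1 \<delta>2 in simp)
qed

lemma absolutely_continuous_on_const [simp]: "absolutely_continuous_on S (\<lambda>x. c)"
  by (rule absolutely_continuous_onI) (auto intro: exI[of _ 1])

lemma absolutely_continuous_on_dominated: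
  assumes g: "absolutely_continuous_on S g"
    and f: "\<And>x y. x \<le> y \<Longrightarrow> {x..y} \<subseteq> S \<Longrightarrow> norm (f y - f x) \<le> C * norm (g y - g x)"
  shows "absolutely_continuous_on S f"
proof (rule absolutely_continuous_onI)
  fix \<epsilon> :: real assume "\<epsilon> > 0"
  \<comment> \<open>The factor \<open>C\<close> may be zero or negative;
    \<open>\<bar>C\<bar> + 1\<close> is a positive upper bound by which one can divide.\<close>
  then have "\<epsilon> / (\<bar>C\<bar> + 1) > 0" by simp
  from absolutely_continuous_onE[OF g this] obtain \<delta> where \<delta>: "\<delta> > 0"
    "\<And>n a b. interval_family S n a b \<Longrightarrow> (\<Sum>k<n. b k - a k) < \<delta> \<Longrightarrow>
      (\<Sum>k<n. norm (g (b k) - g (a k))) < \<epsilon> / (\<bar>C\<bar> + 1)" by blast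
  show "\<exists>\<delta>>0. \<forall>n a b. interval_family S n a b \<longrightarrow>
     (\<Sum>k<n. b k - a k) < \<delta> \<longrightarrow> (\<Sum>k<n. norm (f (b k) - f (a k))) < \<epsilon>"
  proof (intro exI[of _ \<delta>] conjI allI impI)
    fix n a b assume *: "interval_family S n a b" "(\<Sum>k<n. b k - a k) < \<delta>"
    have "(\<Sum>k<n. norm (f (b k) - f (a k))) \<le> (\<Sum>k<n. C * norm (g (b k) - g (a k)))"
      using f interval_familyD[OF *(1)] by (intro sum_mono) simp
    also have "\<dots> \<le> (\<Sum>k<n. (\<bar>C\<bar> + 1) * norm (g (b k) - g (a k)))"
      by (intro sum_mono mult_right_mono) auto
    also have "\<dots> = (\<bar>C\<bar> + 1) * (\<Sum>k<n. norm (g (b k) - g (a k)))"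
      by (simp add: sum_distrib_left)
    also have "\<dots> < (\<bar>C\<bar> + 1) * (\<epsilon> / (\<bar>C\<bar> + 1))"
      by (rule mult_strict_left_mono[OF \<delta>(2)[OF *]]) linarith
    also have "\<dots> = \<epsilon>" by (simp add: add_nonneg_eq_0_iff)
    finally show "(\<Sum>k<n. norm (f (b k) - f (a k))) < \<epsilon>" .
  qed (rule \<delta>)
qed

lemma absolutely_continuous_on_add:
  "absolutely_continuous_on S f \<Longrightarrow> absolutely_continuous_on S g \<Longrightarrow>
    absolutely_continuous_on S (\<lambda>x. f x + g x)"
  by (erule absolutely_continuous_on_dominated2) (auto simp: add_diff_add norm_triangle_ineq)

lemma absolutely_continuous_on_linear:
  assumes "bounded_linear T" "absolutely_continuous_on S f"
  shows "absolutely_continuous_on S (\<lambda>x. T (f x))"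
proof -
  interpret bounded_linear T by fact
  obtain K where "\<And>x. norm (T x) \<le> norm x * K" using bounded by blast
  then show ?thesis
    by (intro absolutely_continuous_on_dominated[OF assms(2), of _ K])
      (simp add: diff[symmetric] mult.commute)
qed

lemma absolutely_continuous_on_uminus:
  "absolutely_continuous_on S f \<Longrightarrow> absolutely_continuous_on S (\<lambda>x. - f x)"
  by (rule absolutely_continuous_on_linear[OF bounded_linear_minus[OF bounded_linear_ident]])

lemma absolutely_continuous_on_diff:
  "absolutely_continuous_on S f \<Longrightarrow> absolutely_continuous_on S g \<Longrightarrow>
    absolutely_continuous_on S (\<lambda>x. f x - g x)"
  using absolutely_continuous_on_add[of S f "\<lambda>x. - g x"] by (simp add: absolutely_continuous_on_uminus)

lemma absolutely_continuous_on_imp_continuous_on: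
  assumes f: "absolutely_continuous_on {a..b} f"
  shows "continuous_on {a..b} f"
  unfolding continuous_on_iff
proof (intro ballI allI impI)
  fix x e :: real assume x: "x \<in> {a..b}" and "e > 0"
  from absolutely_continuous_onE[OF f \<open>e > 0\<close>] obtain \<delta> where \<delta>: "\<delta> > 0"
    "\<And>n u v. interval_family {a..b} n u v \<Longrightarrow> (\<Sum>k<n. v k - u k) < \<delta> \<Longrightarrow>
      (\<Sum>k<n. norm (f (v k) - f (u k))) < e" by blast
  have *: "norm (f v - f u) < e" if "u \<le> v" "{u..v} \<subseteq> {a..b}" "v - u < \<delta>" for u v
    using \<delta>(2)[of "Suc 0" "\<lambda>_. u" "\<lambda>_. v"] that by (simp add: interval_family_def)
  show "\<exists>d>0. \<forall>x'\<in>{a..b}. dist x' x < d \<longrightarrow> dist (f x') (f x) < e"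
  proof (intro exI[of _ \<delta>] conjI ballI impI)
    fix y assume y: "y \<in> {a..b}" "dist y x < \<delta>"
    then show "dist (f y) (f x) < e"
      using *[of x y] *[of y x] x by (cases "x \<le> y") (auto simp: dist_norm norm_minus_commute)
  qed (use \<delta> in auto)
qed

lemma AC_loc_imp_continuous_on:
  assumes "AC_loc f" shows "continuous_on S f"
proof -
  have "isCont f x" for x
  proof -
    have "continuous_on {x-1..x+1} f"
      using assms absolutely_continuous_on_imp_continuous_on unfolding AC_loc_def by blast
    then have "continuous_on {x-1<..<x+1} f"
      by (rule continuous_on_subset) auto
    then show ?thesis
      by (simp add: continuous_on_eq_continuous_at)
  qed
  then show ?thesis
    by (simp add: continuous_at_imp_continuous_on)
qed

lemma absolutely_continuous_on_bilinear:
  assumes B: "bounded_bilinear p"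
    and f: "absolutely_continuous_on {a..b} f" and g: "absolutely_continuous_on {a..b} g"
  shows "absolutely_continuous_on {a..b} (\<lambda>x. p (f x) (g x))"
proof -
  interpret bounded_bilinear p by fact
  obtain K where K: "K \<ge> 0" "\<And>u v. norm (p u v) \<le> norm u * norm v * K" using nonneg_bounded by blast
  have bdd: "\<exists>M\<ge>0. \<forall>x\<in>{a..b}. norm (h x) \<le> M"
    if "absolutely_continuous_on {a..b} h" for h :: "real \<Rightarrow> 'z::real_normed_vector"
  proof -
    have "bounded (h ` {a..b})"
      using that by (intro compact_imp_bounded compact_continuous_image
          absolutely_continuous_on_imp_continuous_on) auto
    then obtain M where "\<forall>x\<in>{a..b}. norm (h x) \<le> M"
      unfolding bounded_iff by auto
    then show ?thesis
      by (meson abs_ge_self abs_ge_zero order_trans)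
  qed
  obtain M where M: "M \<ge> 0" "\<And>x. x \<in> {a..b} \<Longrightarrow> norm (f x) \<le> M" using bdd[OF f] by blast
  obtain N where N: "N \<ge> 0" "\<And>x. x \<in> {a..b} \<Longrightarrow> norm (g x) \<le> N" using bdd[OF g] by blast
  have "absolutely_continuous_on {a..b} (\<lambda>x. (N * K) *\<^sub>R f x)"
    "absolutely_continuous_on {a..b} (\<lambda>x. (M * K) *\<^sub>R g x)"
    by (intro absolutely_continuous_on_linear[OF bounded_linear_scaleR_right] f g)+
  then show ?thesis
  proof (rule absolutely_continuous_on_dominated2)
    fix x y assume xy: "x \<le> y" "{x..y} \<subseteq> {a..b}"
    have "p (f y) (g y) - p (f x) (g x) = p (f y - f x) (g y) + p (f x) (g y - g x)"
      by (simp add: diff_left diff_right)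
    also have "norm \<dots> \<le> norm (f y - f x) * norm (g y) * K + norm (f x) * norm (g y - g x) * K"
      by (intro norm_triangle_le add_mono K)
    also have "\<dots> \<le> norm (f y - f x) * N * K + M * norm (g y - g x) * K"
      using M N K xy by (intro add_mono mult_right_mono mult_left_mono) auto
    also have "\<dots> = norm ((N * K) *\<^sub>R f y - (N * K) *\<^sub>R f x) + norm ((M * K) *\<^sub>R g y - (M * K) *\<^sub>R g x)"
      using M N K unfolding scaleR_diff_right[symmetric] norm_scaleR by (simp add: mult_ac)
    finally show "norm (p (f y) (g y) - p (f x) (g x)) \<le> \<dots>" .
  qed
qed

section \<open>Indefinite integrals and densities\<close>

text \<open>Lebesgue differentiation from both sides: \<open>integrable_ccontinuous_explicit\<close>
  treats averages over intervals to the right of a point, and its application to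
  \<open>\<lambda>x. g (- x)\<close> covers those to the left. Only increments of \<open>F\<close>
  enter, so its additive constant is free.\<close>

lemma AE_has_vector_derivative_indefinite_integral:
  fixes g :: "real \<Rightarrow> 'b::euclidean_space"
  assumes int: "\<And>a b. g integrable_on {a..b}"
    and F: "\<And>x y. x \<le> y \<Longrightarrow> F y - F x = integral {x..y} g"
  shows "AE x in lebesgue. (F has_vector_derivative g x) (at x)"
proof -
  have "\<And>a b. g integrable_on cbox a b" using int by simp
  from integrable_ccontinuous_explicit[OF this]
  obtain N1 where N1: "negligible N1"
    "\<And>x e. \<lbrakk>x \<notin> N1; 0 < e\<rbrakk> \<Longrightarrow> \<exists>d>0. \<forall>h. 0 < h \<and> h < d \<longrightarrow>
       norm (integral (cbox x (x + h *\<^sub>R One)) g /\<^sub>R h ^ DIM(real) - g x) < e"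
    by blast
  have "\<And>a b. (\<lambda>x. g (- x)) integrable_on cbox a b"
    using int integrable_reflect[of g "- b" "- a" for a b] by (metis cbox_interval minus_minus)
  from integrable_ccontinuous_explicit[OF this]
  obtain N2 where N2: "negligible N2"
    "\<And>x e. \<lbrakk>x \<notin> N2; 0 < e\<rbrakk> \<Longrightarrow> \<exists>d>0. \<forall>h. 0 < h \<and> h < d \<longrightarrow>
       norm (integral (cbox x (x + h *\<^sub>R One)) (\<lambda>x. g (- x)) /\<^sub>R h ^ DIM(real) - g (- x)) < e"
    by blast
  have "negligible (N1 \<union> uminus ` N2)"
    using N1(1) N2(1) by (intro negligible_Un negligible_differentiable_image_negligible[OF order_refl])
      (auto intro!: derivative_intros)
  then have "AE x in lebesgue. x \<notin> N1 \<union> uminus ` N2"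
    unfolding negligible_iff_null_sets by (rule AE_not_in)
  then show ?thesis
  proof eventually_elim
    case (elim x)
    then have x1: "x \<notin> N1" and x2: "- x \<notin> N2" by force+
    show "(F has_vector_derivative g x) (at x)"
      unfolding has_vector_derivative_def has_derivative_at_alt
    proof (intro conjI allI impI)
      fix e :: real assume "e > 0"
      obtain d1 where d1: "d1 > 0" "\<And>h. 0 < h \<Longrightarrow> h < d1 \<Longrightarrow>
          norm (integral {x..x + h} g /\<^sub>R h - g x) < e"
        using N1(2)[OF x1 \<open>e > 0\<close>] by auto
      obtain d2 where d2: "d2 > 0" "\<And>h. 0 < h \<Longrightarrow> h < d2 \<Longrightarrow>
          norm (integral {-x..- x + h} (\<lambda>x. g (- x)) /\<^sub>R h - g x) < e"
        using N2(2)[OF x2 \<open>e > 0\<close>] by auto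
      have scale: "norm (v - h *\<^sub>R g x) \<le> e * h" if "norm (v /\<^sub>R h - g x) < e" "h > 0" for v h
      proof -
        have "v - h *\<^sub>R g x = h *\<^sub>R (v /\<^sub>R h - g x)"
          using that by (simp add: scaleR_diff_right)
        then show ?thesis
          using that by (simp add: mult.commute less_imp_le)
      qed
      show "\<exists>d>0. \<forall>y. norm (y - x) < d \<longrightarrow> norm (F y - F x - (y - x) *\<^sub>R g x) \<le> e * norm (y - x)"
      proof (intro exI[of _ "min d1 d2"] conjI allI impI)
        fix y assume y: "norm (y - x) < min d1 d2"
        consider "y = x" | "y > x" | "y < x" by linarith
        then show "norm (F y - F x - (y - x) *\<^sub>R g x) \<le> e * norm (y - x)"
        proof cases
          case 2
          then show ?thesis
            using scale[OF d1(2)[of "y - x"]] y F[of x y] by simp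
        next
          case 3
          have "integral {-x..- x + (x - y)} (\<lambda>x. g (- x)) = F x - F y"
            using F[of y x] 3 by (simp add: integral_reflect_real)
          moreover have "norm (F y - F x - (y - x) *\<^sub>R g x) = norm (F x - F y - (x - y) *\<^sub>R g x)"
            by (subst norm_minus_cancel[symmetric]) (simp add: algebra_simps)
          ultimately show ?thesis
            using scale[OF d2(2)[of "x - y"]] y 3 by simp
        qed auto
      qed (use d1 d2 in auto)
    qed (rule bounded_linear_scaleR_left)
  qed
qed

text \<open>A Lebesgue null set has a cover by intervals of small total length, across which
  \<open>G\<close> grows by little; hence the Stieltjes measure of \<open>G\<close> is absolutely
  continuous with respect to Lebesgue measure.\<close>

lemma monotone_absolutely_continuous_density:
  fixes G :: "real \<Rightarrow> real"
  assumes mono: "mono G" and ac: "absolutely_continuous_on UNIV G"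
  obtains g where "\<And>x y. x \<le> y \<Longrightarrow> (g has_integral G y - G x) {x..y}"
proof -
  define \<mu> where "\<mu> = interval_measure G"
  have "AC_loc G"
    unfolding AC_loc_def using absolutely_continuous_on_subset[OF ac] by simp
  then have cont: "continuous_on UNIV G"
    by (rule AC_loc_imp_continuous_on)
  have Icc: "emeasure \<mu> {x..y} = ennreal (G y - G x)" if "x \<le> y" for x y
    unfolding \<mu>_def using that mono cont by (intro emeasure_interval_measure_Icc) (auto dest: monoD)
  have sets [simp]: "sets \<mu> = sets borel"
    by (simp add: \<mu>_def)
  \<comment> \<open>The cutoff to a bounded interval serves the covering lemma; the pieces are
    reassembled by a countable union afterwards.\<close>
  have null: "emeasure \<mu> (N \<inter> {-real n..real n}) \<le> ennreal e"
    if N: "N \<in> null_sets lborel" and "e > 0" for N n e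
  proof -
    obtain \<delta> where \<delta>: "\<delta> > 0" "\<And>(I::real set set) a b. finite I \<Longrightarrow>
       (\<And>i. i \<in> I \<Longrightarrow> a i \<le> b i \<and> {a i..b i} \<subseteq> UNIV) \<Longrightarrow>
       (\<And>i j. i \<in> I \<Longrightarrow> j \<in> I \<Longrightarrow> i \<noteq> j \<Longrightarrow> {a i<..<b i} \<inter> {a j<..<b j} = {}) \<Longrightarrow>
       (\<Sum>i\<in>I. b i - a i) < \<delta> \<Longrightarrow> (\<Sum>i\<in>I. norm (G (b i) - G (a i))) < e"
      by (rule absolutely_continuous_on_finite_family[OF ac \<open>e > 0\<close>, where 'i = "real set"]) blast
    let ?S = "N \<inter> {-real n..real n}"
    have S0: "?S \<in> null_sets lebesgue"
      using N by (auto intro!: null_sets_completionI null_set_Int2)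
    then have "?S \<in> lmeasurable" "measure lebesgue ?S = 0"
      by (auto simp: fmeasurableI_null_sets measure_eq_0_null_sets)
    \<comment> \<open>Half of \<delta> makes the total length strictly smaller than \<delta>,
      although the cover is only controlled by \<le>.\<close>
    with \<delta> obtain D where D: "countable D"
        "\<And>K. K \<in> D \<Longrightarrow> K \<subseteq> cbox (-real n) (real n) \<and> K \<noteq> {} \<and> (\<exists>c d. K = cbox c d)"
        "pairwise (\<lambda>A B. interior A \<inter> interior B = {}) D"
        "?S \<subseteq> \<Union>D" "\<Union>D \<in> lmeasurable" "measure lebesgue (\<Union>D) \<le> \<delta> / 2"
      by (rule_tac measurable_outer_intervals_bounded[of ?S "- real n" "real n" "\<delta> / 2"]) auto
    have Icc': "\<exists>c d. K = {c..d} \<and> c \<le> d" if "K \<in> D" for K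
      using D(2)[OF that] by (metis atLeastatMost_empty_iff cbox_interval)
    have lm: "K \<in> lmeasurable" if "K \<in> D" for K
      using D(2)[OF that] lmeasurable_cbox by metis
    have borelD: "K \<in> sets borel" if "K \<in> D" for K
      using Icc'[OF that] by auto
    have mem: "Inf K \<le> x \<and> x \<le> Sup K" if "K \<in> D" "x \<in> K" for K x
      using Icc'[OF that(1)] that(2) by auto
    \<comment> \<open>The cover is countable, but the \<epsilon>-\<delta> clause speaks of finite
      families. Finite subfamilies are bounded uniformly by \<open>e\<close>, and the bound survives
      the increasing limit along \<open>X\<close>.\<close>
    have fin: "emeasure \<mu> (\<Union>T) \<le> ennreal e" if T: "finite T" "T \<subseteq> D" for T
    proof -
      have disj: "{Inf K<..<Sup K} \<inter> {Inf L<..<Sup L} = {}" if KL: "K \<in> T" "L \<in> T" "K \<noteq> L" for K L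
      proof -
        have "interior K \<inter> interior L = {}" 
          using KL D(3) T(2) by (auto simp: pairwise_def)
        moreover obtain c d where "K = {c..d}" "c \<le> d" using Icc' KL T(2) by blast
        moreover obtain c' d' where "L = {c'..d'}" "c' \<le> d'" using Icc' KL T(2) by blast
        ultimately show ?thesis by simp
      qed
      \<comment> \<open>Members of \<open>D\<close> may share endpoints, so their lengths add up
        only modulo null sets.\<close>
      have "(\<Sum>K\<in>T. measure lebesgue K) = measure lebesgue (\<Union>T)"
      proof (rule measure_negligible_finite_Union[symmetric])
        show "pairwise (\<lambda>K L. negligible (K \<inter> L)) T"
          unfolding pairwise_def
        proof (intro ballI impI)
          fix K L assume KL: "K \<in> T" "L \<in> T" "K \<noteq> L"
          have "x \<in> {Inf K, Sup K, Inf L, Sup L}" if "x \<in> K \<inter> L" for x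
          proof -
            have "Inf K \<le> x \<and> x \<le> Sup K" "Inf L \<le> x \<and> x \<le> Sup L"
              using that KL mem by (meson IntD1 IntD2 T(2) subsetD)+
            moreover have "x \<notin> {Inf K<..<Sup K} \<inter> {Inf L<..<Sup L}"
              using disj[OF KL] by blast
            ultimately show ?thesis by auto
          qed
          then have "K \<inter> L \<subseteq> {Inf K, Sup K, Inf L, Sup L}" by blast
          then show "negligible (K \<inter> L)"
            by (rule negligible_subset[rotated]) simp
        qed
        show "K \<in> lmeasurable" if "K \<in> T" for K
          using lm T(2) that by blast
      qed (rule T)
      also have "\<dots> \<le> measure lebesgue (\<Union>D)"
      proof (rule measure_mono_fmeasurable)
        show "\<Union>T \<in> sets lebesgue"
          by (rule sets.finite_Union[OF T(1)]) (use T(2) lm in blast)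
        show "\<Union>T \<subseteq> \<Union>D" using T(2) by blast
      qed (rule D(5))
      also have "\<dots> < \<delta>" using D(6) \<delta>(1) by simp
      also have "(\<Sum>K\<in>T. measure lebesgue K) = (\<Sum>K\<in>T. Sup K - Inf K)"
      proof (rule sum.cong)
        fix K assume "K \<in> T"
        then obtain c d where "K = {c..d}" "c \<le> d" using Icc' T(2) by blast
        then show "measure lebesgue K = Sup K - Inf K" by simp
      qed simp
      finally have len: "(\<Sum>K\<in>T. Sup K - Inf K) < \<delta>" .
      have "(\<Sum>K\<in>T. norm (G (Sup K) - G (Inf K))) < e"
      proof (rule \<delta>(2)[OF T(1) _ _ len])
        fix K L assume "K \<in> T" "L \<in> T" "K \<noteq> L"
        then show "{Inf K<..<Sup K} \<inter> {Inf L<..<Sup L} = {}" by (rule disj)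
      qed (use Icc' T(2) in force)
      moreover have "emeasure \<mu> (\<Union>T) \<le> (\<Sum>K\<in>T. emeasure \<mu> K)"
        using emeasure_subadditive_finite[OF T(1), of "\<lambda>K. K" \<mu>] T(2) borelD by auto
      moreover have "(\<Sum>K\<in>T. emeasure \<mu> K) = (\<Sum>K\<in>T. ennreal (norm (G (Sup K) - G (Inf K))))"
      proof (rule sum.cong)
        fix K assume "K \<in> T"
        then obtain c d where "K = {c..d}" "c \<le> d" using Icc' T(2) by blast
        then show "emeasure \<mu> K = ennreal (norm (G (Sup K) - G (Inf K)))"
          using Icc[of c d] monoD[OF mono, of c d] by simp
      qed simp
      ultimately show ?thesis
        by (simp add: sum_ennreal) (meson ennreal_leI less_imp_le order_trans)
    qed
    show ?thesis
    proof (cases "D = {}")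
      case True
      then show ?thesis using D(4) by simp
    next
      case False
      define X where "X i = (\<Union>k\<in>{..i}. from_nat_into D k)" for i :: nat
      have inD: "from_nat_into D k \<in> D" for k using False by (rule from_nat_into)
      have Xm: "X i \<in> sets \<mu>" for i
        unfolding X_def using inD borelD by (auto intro!: sets.finite_UN)
      have UX: "(\<Union>i. X i) = \<Union>D"
      proof -
        have "(\<Union>i. X i) = \<Union>(range (from_nat_into D))"
          unfolding X_def by blast
        then show ?thesis
          using range_from_nat_into[OF False D(1)] by simp
      qed
      have "incseq X" unfolding X_def by (intro monoI UN_mono) auto
      have "emeasure \<mu> ?S \<le> emeasure \<mu> (\<Union>i. X i)"
      proof (rule emeasure_mono)
        show "?S \<subseteq> (\<Union>i. X i)" using D(4) UX by simp
        show "(\<Union>i. X i) \<in> sets \<mu>" using Xm by (intro sets.countable_UN) auto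
      qed
      also have "\<dots> = (SUP i. emeasure \<mu> (X i))"
        using Xm \<open>incseq X\<close> by (intro SUP_emeasure_incseq[symmetric]) auto
      also have "\<dots> \<le> ennreal e"
      proof (rule SUP_least)
        fix i
        show "emeasure \<mu> (X i) \<le> ennreal e"
          using fin[of "from_nat_into D ` {..i}"] inD unfolding X_def by auto
      qed
      finally show ?thesis .
    qed
  qed
  have "absolutely_continuous lborel \<mu>"
    unfolding absolutely_continuous_def
  proof
    fix N :: "real set" assume N: "N \<in> null_sets lborel"
    then have Nb: "N \<in> sets borel" by auto
    have "N \<inter> {-real n..real n} \<in> null_sets \<mu>" for n
    proof -
      have "emeasure \<mu> (N \<inter> {-real n..real n}) \<le> 0"
      proof (rule ennreal_le_epsilon)
        fix e :: real assume "0 < e"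
        from null[OF N this, of n] show "emeasure \<mu> (N \<inter> {-real n..real n}) \<le> 0 + ennreal e"
          by simp
      qed
      then show ?thesis using Nb by (auto simp: null_sets_def)
    qed
    then have "(\<Union>n. N \<inter> {-real n..real n}) \<in> null_sets \<mu>" by (rule null_sets_UN)
    moreover have "(\<Union>n. N \<inter> {-real n..real n}) = N"
    proof -
      have "\<exists>n. x \<in> {-real n..real n}" for x :: real
      proof -
        obtain n where "\<bar>x\<bar> \<le> real n" using real_arch_simple by blast
        then show ?thesis by (intro exI[of _ n]) auto
      qed
      then show ?thesis by blast
    qed
    ultimately show "N \<in> null_sets \<mu>" by simp
  qed
  then obtain g0 where g0: "g0 \<in> borel_measurable lborel" "density lborel g0 = \<mu>"
    using sigma_finite_measure.Radon_Nikodym[OF sigma_finite_lborel, of \<mu>] by auto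
  define g where "g x = enn2real (g0 x)" for x
  have "(g has_integral G y - G x) {x..y}" if "x \<le> y" for x y
  proof -
    have nn: "(\<integral>\<^sup>+t. g0 t * indicator {x..y} t \<partial>lborel) = ennreal (G y - G x)"
      using Icc[OF that] g0 by (metis emeasure_density atLeastAtMost_borel sets_lborel)
    \<comment> \<open>\<open>enn2real\<close> sends \<infinity> to 0, so \<open>g\<close> reproduces
      \<open>g0\<close> only where the latter is finite; the finite integral makes this so a.e. on
      the interval.\<close>
    have "AE t in lborel. g0 t * indicator {x..y} t \<noteq> \<infinity>"
      using g0 nn by (intro nn_integral_PInf_AE) auto
    then have "AE t in lborel. ennreal (g t * indicator {x..y} t) = g0 t * indicator {x..y} t"
    proof eventually_elim
      case (elim t)
      then show ?case
        by (cases "t \<in> {x..y}") (auto simp: g_def less_top)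
    qed
    then have "(\<integral>\<^sup>+t. ennreal (g t * indicator {x..y} t) \<partial>lborel) = ennreal (G y - G x)"
      using nn by (subst nn_integral_cong_AE[where v = "\<lambda>t. g0 t * indicator {x..y} t"]) auto
    moreover have "G y - G x \<ge> 0" using monoD[OF mono that] by simp
    ultimately have "((\<lambda>t. g t * indicator {x..y} t) has_integral G y - G x) UNIV"
      using g0 by (intro nn_integral_has_integral) (auto simp: g_def)
    moreover have "(\<lambda>t. g t * indicator {x..y} t) = (\<lambda>t. if t \<in> {x..y} then g t else 0)"
      by (auto simp: fun_eq_iff)
    ultimately show ?thesis
      by (simp only: has_integral_restrict_UNIV)
  qed
  then show thesis by (rule that)
qed

section \<open>Variation of absolutely continuous functions\<close>

text \<open>The variation over the whole half-line up to \<open>x\<close>. Partitions are monotone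
  sequences of which only the first n + 1 points count; repetitions are allowed, so clamping a
  partition gives a partition again. The supremum is meaningful for globally bounded variation,
  which the clamped functions below have.\<close>

definition total_variation_upto :: "(real \<Rightarrow> 'a::real_normed_vector) \<Rightarrow> real \<Rightarrow> real" where
  "total_variation_upto f x =
     Sup {\<Sum>k<n. norm (f (t (Suc k)) - f (t k)) | (n::nat) t. mono t \<and> t n \<le> x}"

lemma
  fixes f :: "real \<Rightarrow> 'a::real_normed_vector"
  assumes bdd: "\<forall>t n. mono t \<longrightarrow> (\<Sum>k<n. norm (f (t (Suc k)) - f (t k))) \<le> B"
  shows total_variation_upto_upper:
      "\<And>t n x. mono t \<Longrightarrow> t n \<le> x \<Longrightarrow>
        (\<Sum>k<n. norm (f (t (Suc k)) - f (t k))) \<le> total_variation_upto f x"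
    and total_variation_upto_approx:
      "\<And>x \<eta>. \<eta> > 0 \<Longrightarrow> \<exists>t n. mono t \<and> t n \<le> x \<and>
        total_variation_upto f x - \<eta> < (\<Sum>k<n. norm (f (t (Suc k)) - f (t k)))"
proof -
  let ?V = "\<lambda>x. {\<Sum>k<n. norm (f (t (Suc k)) - f (t k)) | (n::nat) t. mono t \<and> t n \<le> x}"
  have above: "bdd_above (?V x)" for x
    using bdd by (intro bdd_aboveI[of _ B]) blast
  have ne: "?V x \<noteq> {}" for x
  proof -
    have "(\<Sum>k<0. norm (f x - f x)) \<in> ?V x"
      by (intro CollectI exI[of _ "0::nat"] exI[of _ "\<lambda>_. x"]) (auto simp: mono_def)
    then show ?thesis by blast
  qed
  show "(\<Sum>k<n. norm (f (t (Suc k)) - f (t k))) \<le> total_variation_upto f x"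
    if "mono t" "t n \<le> x" for t n x
    unfolding total_variation_upto_def by (rule cSup_upper[OF _ above]) (use that in blast)
  show "\<exists>t n. mono t \<and> t n \<le> x \<and>
      total_variation_upto f x - \<eta> < (\<Sum>k<n. norm (f (t (Suc k)) - f (t k)))" if "\<eta> > 0" for x \<eta>
  proof -
    have "Sup (?V x) - \<eta> < Sup (?V x)" using that by simp
    then obtain s where "s \<in> ?V x" "Sup (?V x) - \<eta> < s"
      using less_cSup_iff[OF ne above] by blast
    then show ?thesis unfolding total_variation_upto_def by blast
  qed
qed

text \<open>Two operations on partitions: one that ends before \<open>x\<close> can be prolonged by
  the points \<open>x\<close> and \<open>y\<close>, and one that ends before \<open>y\<close> can be
  cut at \<open>x\<close>. The first bounds the increment of the variation from below, the second
  from above.\<close>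

lemma
  fixes f :: "real \<Rightarrow> 'a::real_normed_vector"
  assumes bdd: "\<forall>t n. mono t \<longrightarrow> (\<Sum>k<n. norm (f (t (Suc k)) - f (t k))) \<le> B"
  shows norm_diff_le_total_variation:
      "\<And>x y. x \<le> y \<Longrightarrow> norm (f y - f x) \<le> total_variation_upto f y - total_variation_upto f x"
    and total_variation_diff_approx:
      "\<And>x y \<eta>. x \<le> y \<Longrightarrow> \<eta> > 0 \<Longrightarrow> \<exists>s m. mono s \<and> x \<le> s 0 \<and> s m \<le> y \<and>
        total_variation_upto f y - total_variation_upto f x < (\<Sum>k<m. norm (f (s (Suc k)) - f (s k))) + \<eta>"
proof -
  note upper = total_variation_upto_upper[of f, OF bdd]
  note approx = total_variation_upto_approx[of f, OF bdd]
  show "norm (f y - f x) \<le> total_variation_upto f y - total_variation_upto f x"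
    if "x \<le> y" for x y
  proof (rule field_le_epsilon)
    fix \<eta> :: real assume "\<eta> > 0"
    then obtain t n where t: "mono t" "t n \<le> x"
      "total_variation_upto f x - \<eta> < (\<Sum>k<n. norm (f (t (Suc k)) - f (t k)))"
      using approx by blast
    \<comment> \<open>Beyond index n + 1 the sequence stays at \<open>y\<close>, which keeps it
      monotone on all naturals.\<close>
    define t' where "t' k = (if k \<le> n then t k else if k = Suc n then x else y)" for k
    have "mono t'"
    proof (rule incseq_SucI)
      fix k show "t' k \<le> t' (Suc k)"
        using t(1,2) \<open>x \<le> y\<close> by (auto simp: t'_def mono_def not_less_eq_eq dest: antisym)
    qed
    then have "(\<Sum>k<Suc (Suc n). norm (f (t' (Suc k)) - f (t' k))) \<le> total_variation_upto f y"
      by (rule upper) (simp add: t'_def)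
    moreover have "(\<Sum>k<n. norm (f (t' (Suc k)) - f (t' k))) = (\<Sum>k<n. norm (f (t (Suc k)) - f (t k)))"
      by (rule sum.cong) (auto simp: t'_def)
    ultimately have "(\<Sum>k<n. norm (f (t (Suc k)) - f (t k))) + norm (f x - f (t n)) + norm (f y - f x)
        \<le> total_variation_upto f y"
      by (simp add: t'_def)
    moreover have "norm (f x - f (t n)) \<ge> 0" by simp
    ultimately show "norm (f y - f x) \<le> total_variation_upto f y - total_variation_upto f x + \<eta>"
      using t(3) by linarith
  qed
  show "\<exists>s m. mono s \<and> x \<le> s 0 \<and> s m \<le> y \<and>
      total_variation_upto f y - total_variation_upto f x < (\<Sum>k<m. norm (f (s (Suc k)) - f (s k))) + \<eta>"
    if "x \<le> y" "\<eta> > 0" for x y \<eta>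
  proof -
    obtain t n where t: "mono t" "t n \<le> y"
      "total_variation_upto f y - \<eta> < (\<Sum>k<n. norm (f (t (Suc k)) - f (t k)))"
      using approx[OF \<open>\<eta> > 0\<close>] by blast
    \<comment> \<open>Clamping yields both halves of the partition without locating \<open>x\<close>
      in it: cells on the wrong side collapse to points, and a cell that straddles \<open>x\<close>
      is split by the triangle inequality.\<close>
    define l where "l k = min (t k) x" for k
    define r where "r k = max x (t k)" for k
    have "mono l" "mono r"
      using t(1) unfolding mono_def l_def r_def by (auto intro: min.coboundedI1 max.coboundedI2)
    have "norm (f (t (Suc k)) - f (t k)) \<le> norm (f (l (Suc k)) - f (l k)) + norm (f (r (Suc k)) - f (r k))" for k
    proof -
      have "t k \<le> t (Suc k)" using t(1) by (simp add: mono_def)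
      then consider "t (Suc k) \<le> x" | "x \<le> t k" | "t k \<le> x" "x \<le> t (Suc k)" by linarith
      then show ?thesis
      proof cases
        case 3
        have "norm (f (t (Suc k)) - f (t k)) \<le> norm (f x - f (t k)) + norm (f (t (Suc k)) - f x)"
          using norm_triangle_ineq[of "f x - f (t k)" "f (t (Suc k)) - f x"] by simp
        then show ?thesis using 3 by (simp add: l_def r_def min_def max_def)
      qed (use \<open>t k \<le> t (Suc k)\<close> in \<open>auto simp: l_def r_def min_def max_def\<close>)
    qed
    then have "(\<Sum>k<n. norm (f (t (Suc k)) - f (t k))) \<le>
        (\<Sum>k<n. norm (f (l (Suc k)) - f (l k)) + norm (f (r (Suc k)) - f (r k)))"
      by (intro sum_mono)
    also have "\<dots> = (\<Sum>k<n. norm (f (l (Suc k)) - f (l k))) + (\<Sum>k<n. norm (f (r (Suc k)) - f (r k)))"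
      by (rule sum.distrib)
    also have "(\<Sum>k<n. norm (f (l (Suc k)) - f (l k))) \<le> total_variation_upto f x"
      using \<open>mono l\<close> by (rule upper) (simp add: l_def)
    finally have "total_variation_upto f y - total_variation_upto f x < (\<Sum>k<n. norm (f (r (Suc k)) - f (r k))) + \<eta>"
      using t(3) by linarith
    moreover have "x \<le> r 0" "r n \<le> y"
      using t(2) \<open>x \<le> y\<close> by (auto simp: r_def)
    ultimately show ?thesis using \<open>mono r\<close> by blast
  qed
qed

text \<open>Each interval is replaced by a nearly optimal partition inside it. All cells together
  form one family of no greater total length, so the modulus of \<open>f\<close> for \<epsilon>/2
  applies; the other \<epsilon>/2 pays for the approximation errors.\<close>

lemma absolutely_continuous_on_total_variation:
  fixes f :: "real \<Rightarrow> 'a::real_normed_vector"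
  assumes ac: "absolutely_continuous_on UNIV f"
    and bdd: "\<forall>t n. mono t \<longrightarrow> (\<Sum>k<n. norm (f (t (Suc k)) - f (t k))) \<le> B"
  shows "absolutely_continuous_on UNIV (total_variation_upto f)"
proof (rule absolutely_continuous_onI)
  fix \<epsilon> :: real assume "\<epsilon> > 0"
  then have e2: "\<epsilon> / 2 > 0" by simp
  let ?v = "total_variation_upto f"
  obtain \<delta> where "\<delta> > 0" and \<delta>: "\<And>(I::(nat \<times> nat) set) a b. finite I \<Longrightarrow>
       (\<And>i. i \<in> I \<Longrightarrow> a i \<le> b i \<and> {a i..b i} \<subseteq> UNIV) \<Longrightarrow>
       (\<And>i j. i \<in> I \<Longrightarrow> j \<in> I \<Longrightarrow> i \<noteq> j \<Longrightarrow> {a i<..<b i} \<inter> {a j<..<b j} = {}) \<Longrightarrow>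
       (\<Sum>i\<in>I. b i - a i) < \<delta> \<Longrightarrow> (\<Sum>i\<in>I. norm (f (b i) - f (a i))) < \<epsilon> / 2"
    by (rule absolutely_continuous_on_finite_family[OF ac e2, where 'i = "nat \<times> nat"]) blast
  show "\<exists>\<delta>>0. \<forall>n a b. interval_family UNIV n a b \<longrightarrow>
     (\<Sum>k<n. b k - a k) < \<delta> \<longrightarrow> (\<Sum>k<n. norm (?v (b k) - ?v (a k))) < \<epsilon>"
  proof (intro exI[of _ \<delta>] conjI allI impI)
    fix n a b assume ab: "interval_family UNIV n a b" "(\<Sum>k<n. b k - a k) < \<delta>"
    \<comment> \<open>An error \<eta> is made once per interval, n times in all;
      \<open>Suc n\<close> keeps the denominator nonzero for the empty family.\<close>
    define \<eta> where "\<eta> = \<epsilon> / (2 * real (Suc n))"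
    have "\<eta> > 0" using \<open>\<epsilon> > 0\<close> by (simp add: \<eta>_def)
    define Q where "Q k s m \<longleftrightarrow> mono s \<and> a k \<le> s 0 \<and> s m \<le> b k \<and>
        ?v (b k) - ?v (a k) < (\<Sum>j<m. norm (f (s (Suc j)) - f (s j))) + \<eta>" for k s m
    have "\<forall>k. \<exists>s m. k < n \<longrightarrow> Q k s m"
      using interval_familyD[OF ab(1)] total_variation_diff_approx[of f, OF bdd _ \<open>\<eta> > 0\<close>]
      unfolding Q_def by blast
    then obtain s where "\<forall>k. \<exists>m. k < n \<longrightarrow> Q k (s k) m"
      by (rule choice[THEN exE])
    then obtain m where "\<forall>k. k < n \<longrightarrow> Q k (s k) (m k)"
      by (rule choice[THEN exE])
    then have sm: "\<And>k. k < n \<Longrightarrow> mono (s k) \<and> a k \<le> s k 0 \<and> s k (m k) \<le> b k \<and>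
        ?v (b k) - ?v (a k) < (\<Sum>j<m k. norm (f (s k (Suc j)) - f (s k j))) + \<eta>"
      unfolding Q_def by simp
    define I where "I = (SIGMA k:{..<n}. {..<m k})"
    have sumI: "(\<Sum>i\<in>I. h (fst i) (snd i)) = (\<Sum>k<n. \<Sum>j<m k. h k j)" for h :: "nat \<Rightarrow> nat \<Rightarrow> real"
      unfolding I_def by (simp add: sum.Sigma split_beta)
    have "(\<Sum>i\<in>I. norm (f (s (fst i) (Suc (snd i))) - f (s (fst i) (snd i)))) < \<epsilon> / 2"
    proof (rule \<delta>)
      show "finite I" by (simp add: I_def)
      show "s (fst i) (snd i) \<le> s (fst i) (Suc (snd i)) \<and> {s (fst i) (snd i)..s (fst i) (Suc (snd i))} \<subseteq> UNIV"
        if "i \<in> I" for i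
        using that sm by (auto simp: I_def mono_def)
      have inside: "a (fst i) \<le> s (fst i) (snd i) \<and> s (fst i) (Suc (snd i)) \<le> b (fst i)" if "i \<in> I" for i
      proof -
        have k: "fst i < n" "Suc (snd i) \<le> m (fst i)" using that by (auto simp: I_def)
        then show ?thesis
          using sm[OF k(1)] monoD[of "s (fst i)" 0 "snd i"] monoD[of "s (fst i)" _ "m (fst i)", OF _ k(2)]
          by linarith
      qed
      show "{s (fst i) (snd i)<..<s (fst i) (Suc (snd i))} \<inter> {s (fst j) (snd j)<..<s (fst j) (Suc (snd j))} = {}"
        if ij: "i \<in> I" "j \<in> I" "i \<noteq> j" for i j
      proof (cases "fst i = fst j")
        case True
        then have "snd i < snd j \<or> snd j < snd i"
          using ij(3) by (metis linorder_neqE_nat prod_eqI)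
        moreover have "mono (s (fst i))"
          using sm ij(1) by (auto simp: I_def)
        ultimately have "s (fst i) (Suc (snd i)) \<le> s (fst i) (snd j) \<or> s (fst i) (Suc (snd j)) \<le> s (fst i) (snd i)"
          by (metis Suc_leI monoD)
        with True show ?thesis by auto
      next
        case False
        then have "{a (fst i)<..<b (fst i)} \<inter> {a (fst j)<..<b (fst j)} = {}"
          using ab(1) ij unfolding interval_family_def by (auto simp: I_def)
        then show ?thesis
          using inside[OF ij(1)] inside[OF ij(2)] by (force simp: disjoint_iff)
      qed
      have "(\<Sum>i\<in>I. s (fst i) (Suc (snd i)) - s (fst i) (snd i)) = (\<Sum>k<n. \<Sum>j<m k. s k (Suc j) - s k j)"
        by (rule sumI)
      also have "\<dots> = (\<Sum>k<n. s k (m k) - s k 0)"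
        by (simp add: sum_lessThan_telescope)
      also have "\<dots> \<le> (\<Sum>k<n. b k - a k)"
        using sm by (intro sum_mono diff_mono) auto
      finally show "(\<Sum>i\<in>I. s (fst i) (Suc (snd i)) - s (fst i) (snd i)) < \<delta>"
        using ab(2) by simp
    qed
    then have small: "(\<Sum>k<n. \<Sum>j<m k. norm (f (s k (Suc j)) - f (s k j))) < \<epsilon> / 2"
      unfolding sumI[of "\<lambda>k j. norm (f (s k (Suc j)) - f (s k j))"] .
    have "(\<Sum>k<n. norm (?v (b k) - ?v (a k))) \<le> (\<Sum>k<n. (\<Sum>j<m k. norm (f (s k (Suc j)) - f (s k j))) + \<eta>)"
    proof (rule sum_mono)
      fix k assume "k \<in> {..<n}"
      then have k: "k < n" by simp
      have "0 \<le> norm (f (b k) - f (a k))" by simp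
      also have "\<dots> \<le> ?v (b k) - ?v (a k)"
        using interval_familyD[OF ab(1) k] by (intro norm_diff_le_total_variation[of f, OF bdd]) auto
      finally have "norm (?v (b k) - ?v (a k)) = ?v (b k) - ?v (a k)" by simp
      then show "norm (?v (b k) - ?v (a k)) \<le> (\<Sum>j<m k. norm (f (s k (Suc j)) - f (s k j))) + \<eta>"
        using sm[OF k] by linarith
    qed
    also have "\<dots> = (\<Sum>k<n. \<Sum>j<m k. norm (f (s k (Suc j)) - f (s k j))) + real n * \<eta>"
      by (simp add: sum.distrib)
    also have "real n * \<eta> \<le> \<epsilon> / 2"
      using \<open>\<epsilon> > 0\<close> by (simp add: \<eta>_def field_simps)
    finally show "(\<Sum>k<n. norm (?v (b k) - ?v (a k))) < \<epsilon>"
      using small by linarith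
  qed (rule \<open>\<delta> > 0\<close>)
qed

lemma absolutely_continuous_short_interval_density:
  fixes f :: "real \<Rightarrow> real"
  assumes ac: "absolutely_continuous_on {a..b} f"
  obtains \<delta> where "\<delta> > 0"
    "\<And>c d. a \<le> c \<Longrightarrow> c \<le> d \<Longrightarrow> d \<le> b \<Longrightarrow> d - c < \<delta> \<Longrightarrow>
      \<exists>g. \<forall>x y. x \<le> y \<longrightarrow> (g has_integral f (max c (min d y)) - f (max c (min d x))) {x..y}"
proof -
  obtain \<delta> where "\<delta> > 0" and \<delta>: "\<And>n u v. interval_family {a..b} n u v \<Longrightarrow>
      (\<Sum>k<n. v k - u k) < \<delta> \<Longrightarrow> (\<Sum>k<n. norm (f (v k) - f (u k))) < 1"
    by (rule absolutely_continuous_onE[OF ac zero_less_one]) blast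
  show thesis
  proof (rule that[OF \<open>\<delta> > 0\<close>])
    fix c d assume cd: "a \<le> c" "c \<le> d" "d \<le> b" "d - c < \<delta>"
    \<comment> \<open>Clamping extends \<open>f\<close> from [c, d] to the line by constants. As
      \<open>p\<close> is monotone and increases no distance, families on the line are carried to
      families in [c, d] of no greater length; by \<open>pinside\<close>, disjoint interiors stay
      disjoint.\<close>
    define p where "p x = max c (min d x)" for x
    have p: "c \<le> p x" "p x \<le> d" for x using cd by (auto simp: p_def)
    have pmono: "p x \<le> p y" if "x \<le> y" for x y using that by (auto simp: p_def)
    have plen: "p y - p x \<le> y - x" if "x \<le> y" for x y using that by (auto simp: p_def)
    have pinside: "x < z \<and> z < y" if "p x < z" "z < p y" for x y z
      using that cd by (auto simp: p_def max_def min_def split: if_splits)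
    have fam: "interval_family {a..b} n (\<lambda>k. p (u k)) (\<lambda>k. p (v k))"
      if "interval_family UNIV n u v" for n u v
      unfolding interval_family_def
    proof (intro conjI allI impI)
      fix k assume "k < n"
      then show "p (u k) \<le> p (v k)" using interval_familyD[OF that] pmono by blast
      show "{p (u k)..p (v k)} \<subseteq> {a..b}" using p[of "u k"] p[of "v k"] cd by auto
    next
      fix i j assume ij: "i < n" "j < n" "i \<noteq> j"
      then have "{u i<..<v i} \<inter> {u j<..<v j} = {}"
        using that unfolding interval_family_def by blast
      then show "{p (u i)<..<p (v i)} \<inter> {p (u j)<..<p (v j)} = {}"
        using pinside by (meson disjoint_iff greaterThanLessThan_iff)
    qed
    define h where "h x = f (p x)" for x
    have "absolutely_continuous_on UNIV h"
    proof (rule absolutely_continuous_onI)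
      fix \<epsilon> :: real assume "\<epsilon> > 0"
      from absolutely_continuous_onE[OF ac this] obtain \<delta>' where \<delta>': "\<delta>' > 0"
        "\<And>n u v. interval_family {a..b} n u v \<Longrightarrow> (\<Sum>k<n. v k - u k) < \<delta>' \<Longrightarrow>
          (\<Sum>k<n. norm (f (v k) - f (u k))) < \<epsilon>" by blast
      show "\<exists>\<delta>>0. \<forall>n u v. interval_family UNIV n u v \<longrightarrow> (\<Sum>k<n. v k - u k) < \<delta> \<longrightarrow>
         (\<Sum>k<n. norm (h (v k) - h (u k))) < \<epsilon>"
      proof (intro exI[of _ \<delta>'] conjI allI impI)
        fix n u v assume uv: "interval_family UNIV n u v" "(\<Sum>k<n. v k - u k) < \<delta>'"
        have "(\<Sum>k<n. p (v k) - p (u k)) \<le> (\<Sum>k<n. v k - u k)"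
          using interval_familyD[OF uv(1)] by (intro sum_mono plen) auto
        then show "(\<Sum>k<n. norm (h (v k) - h (u k))) < \<epsilon>"
          unfolding h_def using uv(2) by (intro \<delta>'(2)[OF fam[OF uv(1)]]) simp
      qed (rule \<delta>')
    qed
    note ach = this
    have bdd: "\<forall>t n. mono t \<longrightarrow> (\<Sum>k<n. norm (h (t (Suc k)) - h (t k))) \<le> 1"
    proof (intro allI impI)
      fix t :: "nat \<Rightarrow> real" and n assume t: "mono t"
      have "interval_family UNIV n t (\<lambda>k. t (Suc k))"
        unfolding interval_family_def
      proof (intro conjI allI impI)
        fix i j :: nat assume "i \<noteq> j"
        then have "Suc i \<le> j \<or> Suc j \<le> i" by auto
        then have "t (Suc i) \<le> t j \<or> t (Suc j) \<le> t i" using monoD[OF t] by blast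
        then show "{t i<..<t (Suc i)} \<inter> {t j<..<t (Suc j)} = {}" by auto
      qed (use t in \<open>auto simp: mono_def\<close>)
      from fam[OF this] have "interval_family {a..b} n (\<lambda>k. p (t k)) (\<lambda>k. p (t (Suc k)))" .
      moreover have "(\<Sum>k<n. p (t (Suc k)) - p (t k)) < \<delta>"
        using p(1)[of "t 0"] p(2)[of "t n"] cd(4)
        by (simp add: sum_lessThan_telescope[of "\<lambda>k. p (t k)"])
      ultimately show "(\<Sum>k<n. norm (h (t (Suc k)) - h (t k))) \<le> 1"
        unfolding h_def by (intro less_imp_le \<delta>)
    qed
    let ?v = "total_variation_upto h"
    have acv: "absolutely_continuous_on UNIV ?v"
      by (rule absolutely_continuous_on_total_variation[OF ach bdd])
    have incr: "\<bar>h y - h x\<bar> \<le> ?v y - ?v x" if "x \<le> y" for x y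
      using norm_diff_le_total_variation[of h, OF bdd that] by simp
    have "mono ?v"
    proof (rule monoI)
      fix x y :: real assume "x \<le> y"
      from incr[OF this] show "?v x \<le> ?v y" by linarith
    qed
    from monotone_absolutely_continuous_density[OF this acv]
    obtain g1 where g1: "\<And>x y. x \<le> y \<Longrightarrow> (g1 has_integral ?v y - ?v x) {x..y}" by blast
    have "mono (\<lambda>x. ?v x - h x)"
    proof (rule monoI)
      fix x y :: real assume "x \<le> y"
      from incr[OF this] show "?v x - h x \<le> ?v y - h y" by linarith
    qed
    from monotone_absolutely_continuous_density[OF this absolutely_continuous_on_diff[OF acv ach]]
    obtain g2 where g2: "\<And>x y. x \<le> y \<Longrightarrow> (g2 has_integral (?v y - h y) - (?v x - h x)) {x..y}" by blast
    have "((\<lambda>x. g1 x - g2 x) has_integral h y - h x) {x..y}" if "x \<le> y" for x y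
      using has_integral_diff[OF g1[OF that] g2[OF that]] by simp
    then show "\<exists>g. \<forall>x y. x \<le> y \<longrightarrow> (g has_integral f (max c (min d y)) - f (max c (min d x))) {x..y}"
      unfolding h_def p_def by blast
  qed
qed

section \<open>The fundamental theorem of calculus\<close>

lemma AC_loc_has_integral_vd_real:
  fixes f :: "real \<Rightarrow> real"
  assumes ac: "AC_loc f" and "a \<le> b"
  shows "(vd f has_integral f b - f a) {a..b}"
  using \<open>a \<le> b\<close>
proof (induction a b rule: Bolzano)
  case (trans a b c)
  from has_integral_combine[OF trans(3,4) trans(1,2)] show ?case by simp
next
  case (local x)
  obtain \<delta> where "\<delta> > 0" and \<delta>: "\<And>c d. x - 1 \<le> c \<Longrightarrow> c \<le> d \<Longrightarrow> d \<le> x + 1 \<Longrightarrow> d - c < \<delta> \<Longrightarrow>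
      \<exists>g. \<forall>u v. u \<le> v \<longrightarrow> (g has_integral f (max c (min d v)) - f (max c (min d u))) {u..v}"
    using ac unfolding AC_loc_def
    by (rule_tac absolutely_continuous_short_interval_density[of "x - 1" "x + 1" f]) blast+
  define \<eta> where "\<eta> = min (\<delta> / 3) 1"
  have \<eta>: "\<eta> > 0" "\<eta> \<le> 1" "2 * \<eta> < \<delta>"
    using \<open>\<delta> > 0\<close> by (auto simp: \<eta>_def min_def)
  define p where "p u = max (x - \<eta>) (min (x + \<eta>) u)" for u
  obtain g where g: "\<And>u v. u \<le> v \<Longrightarrow> (g has_integral f (p v) - f (p u)) {u..v}"
    using \<delta>[of "x - \<eta>" "x + \<eta>"] \<eta> unfolding p_def by auto
  have "AE t in lebesgue. ((\<lambda>u. f (p u)) has_vector_derivative g t) (at t)"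
  proof (rule AE_has_vector_derivative_indefinite_integral)
    fix u v :: real
    show "g integrable_on {u..v}"
      using g[of u v] by (cases "u \<le> v") (auto intro: has_integral_integrable)
    show "f (p v) - f (p u) = integral {u..v} g" if "u \<le> v"
      using g[OF that] by (simp add: integral_unique)
  qed
  then obtain N where N: "negligible N"
    "\<And>t. t \<notin> N \<Longrightarrow> ((\<lambda>u. f (p u)) has_vector_derivative g t) (at t)"
    unfolding eventually_ae_filter_negligible by blast
  have vd: "vd f t = g t" if t: "x - \<eta> < t" "t < x + \<eta>" "t \<notin> N" for t
  proof -
    \<comment> \<open>Strictly inside the window the clamp is the identity, so \<open>f\<close> and
      its clamped version have the same derivative.\<close>
    have "(f has_vector_derivative g t) (at t)"
      using N(2)[OF t(3)]
      by (rule has_vector_derivative_transform_within_open[of _ _ _ "{x - \<eta><..<x + \<eta>}"])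
        (use t in \<open>auto simp: p_def\<close>)
    then show ?thesis unfolding vd_def by (rule vector_derivative_at)
  qed
  have "(vd f has_integral f v - f u) {u..v}" if uv: "u \<le> x" "x \<le> v" "v - u < \<eta>" for u v
  proof (rule has_integral_spike[OF N(1)])
    show "vd f t = g t" if "t \<in> {u..v} - N" for t
      using that uv \<eta>(1) by (intro vd) auto
    have "p u = u" "p v = v" using uv by (auto simp: p_def)
    then show "(g has_integral f v - f u) {u..v}"
      using g[of u v] uv by simp
  qed
  then show ?case using \<eta>(1) by blast
qed

lemma AC_loc_linear:
  assumes "bounded_linear T" "AC_loc f"
  shows "AC_loc (\<lambda>x. T (f x))"
  using assms absolutely_continuous_on_linear unfolding AC_loc_def by blast

text \<open>Each coordinate is the indefinite integral of its own \<open>vd\<close> by the scalar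
  case, hence differentiable a.e.\<close>

lemma AC_loc_AE_differentiable:
  fixes f :: "real \<Rightarrow> 'a::euclidean_space"
  assumes ac: "AC_loc f"
  shows "AE x in lebesgue. (f has_vector_derivative vd f x) (at x)"
proof -
  have comp: "AC_loc (\<lambda>x. f x \<bullet> i)" for i
    by (rule AC_loc_linear[OF bounded_linear_inner_left ac])
  have "AE x in lebesgue. ((\<lambda>x. f x \<bullet> i) has_vector_derivative vd (\<lambda>x. f x \<bullet> i) x) (at x)" for i
  proof (rule AE_has_vector_derivative_indefinite_integral)
    fix u v :: real
    show "vd (\<lambda>x. f x \<bullet> i) integrable_on {u..v}"
      using AC_loc_has_integral_vd_real[OF comp, of u v i]
      by (cases "u \<le> v") (auto intro: has_integral_integrable)
    show "f v \<bullet> i - f u \<bullet> i = integral {u..v} (vd (\<lambda>x. f x \<bullet> i))" if "u \<le> v"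
      by (rule integral_unique[OF AC_loc_has_integral_vd_real[OF comp that], symmetric])
  qed
  then have "AE x in lebesgue. \<forall>i\<in>Basis. ((\<lambda>x. f x \<bullet> i) has_vector_derivative vd (\<lambda>x. f x \<bullet> i) x) (at x)"
    by (intro AE_finite_allI) auto
  then show ?thesis
  proof eventually_elim
    case (elim x)
    have "((\<lambda>x. \<Sum>i\<in>Basis. (f x \<bullet> i) *\<^sub>R i) has_vector_derivative
        (\<Sum>i\<in>Basis. vd (\<lambda>x. f x \<bullet> i) x *\<^sub>R i)) (at x)"
      using elim by (intro has_vector_derivative_sum)
        (auto intro: bounded_linear.has_vector_derivative[OF bounded_linear_scaleR_left])
    then have "(f has_vector_derivative (\<Sum>i\<in>Basis. vd (\<lambda>x. f x \<bullet> i) x *\<^sub>R i)) (at x)"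
      by (simp add: euclidean_representation)
    then show ?case unfolding vd_def by (metis vector_derivative_at)
  qed
qed

lemma AE_vd_eqI:
  "AE x in lebesgue. (f has_vector_derivative f' x) (at x) \<Longrightarrow> AE x in lebesgue. vd f x = f' x"
  unfolding vd_def by (erule eventually_mono) (rule vector_derivative_at)

theorem AC_loc_has_integral:
  fixes f :: "real \<Rightarrow> 'a::euclidean_space"
  assumes ac: "AC_loc f" and "a \<le> b"
    and f': "AE x in lebesgue. (f has_vector_derivative f' x) (at x)"
  shows "(f' has_integral f b - f a) {a..b}"
proof (subst has_integral_componentwise_iff, intro ballI)
  fix i :: 'a assume "i \<in> Basis"
  have "AE x in lebesgue. ((\<lambda>x. f x \<bullet> i) has_vector_derivative f' x \<bullet> i) (at x)"
    using f' by eventually_elim (rule bounded_linear.has_vector_derivative[OF bounded_linear_inner_left])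
  from AE_vd_eqI[OF this] obtain N where N: "negligible N" "\<And>x. x \<notin> N \<Longrightarrow> vd (\<lambda>x. f x \<bullet> i) x = f' x \<bullet> i"
    unfolding eventually_ae_filter_negligible by blast
  have "AC_loc (\<lambda>x. f x \<bullet> i)"
    by (rule AC_loc_linear[OF bounded_linear_inner_left ac])
  from AC_loc_has_integral_vd_real[OF this \<open>a \<le> b\<close>]
  have "(vd (\<lambda>x. f x \<bullet> i) has_integral (f b - f a) \<bullet> i) {a..b}"
    by (simp add: inner_diff_left)
  then show "((\<lambda>x. f' x \<bullet> i) has_integral (f b - f a) \<bullet> i) {a..b}"
    by (rule has_integral_spike[OF N(1), rotated]) (simp add: N(2))
qed

lemma AC_loc_zero_derivative_imp_constant:
  fixes f :: "real \<Rightarrow> 'a::euclidean_space"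
  assumes "AC_loc f" "AE x in lebesgue. (f has_vector_derivative 0) (at x)"
  shows "f x = f y"
proof -
  have "f v = f u" if "u \<le> v" for u v
    using AC_loc_has_integral[OF assms(1) that, of "\<lambda>_. 0"] assms(2)
    by (metis has_integral_0_eq eq_iff_diff_eq_0)
  then show ?thesis by (metis linear)
qed

text \<open>Restricting \<open>r\<close> to the open intervals makes the summands vanish at shared
  endpoints, so at each point at most one is nonzero and the sum stays below
  \<open>r\<close>.\<close>

lemma sum_integral_interval_family_le:
  fixes r :: "real \<Rightarrow> real"
  assumes r: "r integrable_on {a..b}" "\<And>x. r x \<ge> 0" and fam: "interval_family {a..b} n u v"
  shows "(\<Sum>j<n. integral {u j..v j} r) \<le> integral {a..b} r"
proof -
  have uv: "u j \<le> v j" "{u j..v j} \<subseteq> {a..b}" if "j < n" for j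
    using interval_familyD[OF fam that] by auto
  have hi: "((\<lambda>t. if t \<in> {u j<..<v j} then r t else 0) has_integral integral {u j..v j} r) {a..b}"
    if "j < n" for j
  proof -
    have "r integrable_on {u j..v j}"
      using integrable_on_subinterval[OF r(1)] uv[OF that] by simp
    then have "(r has_integral integral {u j..v j} r) {u j<..<v j}"
      using has_integral_Icc_iff_Ioo by blast
    then show ?thesis
      using uv[OF that] by (subst has_integral_restrict) auto
  qed
  have "((\<lambda>t. \<Sum>j<n. if t \<in> {u j<..<v j} then r t else 0) has_integral (\<Sum>j<n. integral {u j..v j} r)) {a..b}"
    using hi by (intro has_integral_sum) auto
  moreover have "(r has_integral integral {a..b} r) {a..b}"
    using r(1) by (rule integrable_integral)
  moreover have "(\<Sum>j<n. if t \<in> {u j<..<v j} then r t else 0) \<le> r t" for t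
  proof (cases "\<exists>i<n. t \<in> {u i<..<v i}")
    case True
    then obtain i where i: "i < n" "t \<in> {u i<..<v i}" by blast
    have "t \<notin> {u j<..<v j}" if "j < n" "j \<noteq> i" for j
      using fam i that unfolding interval_family_def by blast
    then have "(\<Sum>j<n. if t \<in> {u j<..<v j} then r t else 0) = (\<Sum>j<n. if j = i then r t else 0)"
      using i by (intro sum.cong) auto
    then show ?thesis using i by simp
  next
    case False
    then have "(\<Sum>j<n. if t \<in> {u j<..<v j} then r t else 0) = 0"
      by (intro sum.neutral) auto
    then show ?thesis using r(2) by simp
  qed
  ultimately show ?thesis by (rule has_integral_le)
qed

text \<open>The norm of the integrand is cut at height M: the excess \<open>r M\<close> has small
  integral for large M by dominated convergence, and the bounded part contributes at most M times
  the length.\<close>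

lemma AC_loc_indefinite_integral:
  fixes g :: "real \<Rightarrow> 'a::euclidean_space"
  assumes g: "\<And>a b. g absolutely_integrable_on {a..b}"
    and F: "\<And>x y. x \<le> y \<Longrightarrow> F y - F x = integral {x..y} g"
  shows "AC_loc F"
  unfolding AC_loc_def
proof (intro allI absolutely_continuous_onI)
  fix a b \<epsilon> :: real assume "\<epsilon> > 0"
  define k where "k x = norm (g x)" for x
  have k: "k absolutely_integrable_on {a..b}" for a b
    unfolding k_def by (rule absolutely_integrable_norm[OF g, unfolded o_def])
  have ki: "k integrable_on {a..b}" for a b
    using k set_lebesgue_integral_eq_integral(1) by blast
  have mi: "(\<lambda>x. min (k x) M) integrable_on {a..b}" for a b M
    using absolutely_integrable_min_1[OF k absolutely_integrable_on_const[of "{a..b}" M]]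
      set_lebesgue_integral_eq_integral(1) by force
  define r where "r M x = k x - min (k x) (real M)" for M :: nat and x
  have ri: "r M integrable_on {a..b}" for M a b
    unfolding r_def by (intro integrable_diff ki mi)
  have "(\<lambda>M. integral {a..b} (r M)) \<longlonglongrightarrow> integral {a..b} (\<lambda>_. 0)"
  proof (rule dominated_convergence(2)[OF ri ki[of a b]])
    show "norm (r M x) \<le> k x" for M x
      by (auto simp: r_def min_def k_def)
    show "(\<lambda>M. r M x) \<longlonglongrightarrow> 0" for x
    proof (rule tendsto_eventually)
      obtain M0 where "k x \<le> real M0" using real_arch_simple by blast
      then show "\<forall>\<^sub>F M in sequentially. r M x = 0"
        unfolding eventually_sequentially r_def by (intro exI[of _ M0]) auto
    qed
  qed
  then have "(\<lambda>M. integral {a..b} (r M)) \<longlonglongrightarrow> 0" by simp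
  then have "\<forall>\<^sub>F M in sequentially. integral {a..b} (r M) < \<epsilon> / 2"
    using \<open>\<epsilon> > 0\<close> by (intro order_tendstoD(2)) auto
  then obtain M where M: "integral {a..b} (r M) < \<epsilon> / 2"
    unfolding eventually_sequentially by blast
  show "\<exists>\<delta>>0. \<forall>n u v. interval_family {a..b} n u v \<longrightarrow> (\<Sum>j<n. v j - u j) < \<delta> \<longrightarrow>
         (\<Sum>j<n. norm (F (v j) - F (u j))) < \<epsilon>"
  \<comment> \<open>\<open>Suc M\<close> in place of \<open>M\<close> avoids a division by zero when
    M = 0.\<close>
  proof (intro exI[of _ "\<epsilon> / (2 * real (Suc M))"] conjI allI impI)
    fix n u v assume fam: "interval_family {a..b} n u v"
      and len: "(\<Sum>j<n. v j - u j) < \<epsilon> / (2 * real (Suc M))"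
    have "(\<Sum>j<n. norm (F (v j) - F (u j))) \<le> (\<Sum>j<n. integral {u j..v j} (r M) + real M * (v j - u j))"
    proof (rule sum_mono)
      fix j assume "j \<in> {..<n}"
      then have uv: "u j \<le> v j" using interval_familyD[OF fam] by simp
      have "norm (F (v j) - F (u j)) = norm (integral {u j..v j} g)" using F[OF uv] by simp
      also have "\<dots> \<le> integral {u j..v j} k"
        using g[THEN set_lebesgue_integral_eq_integral(1)] ki
        by (intro integral_norm_bound_integral) (auto simp: k_def)
      also have "\<dots> \<le> integral {u j..v j} (\<lambda>x. r M x + real M)"
      proof (rule integral_le)
        show "(\<lambda>x. r M x + real M) integrable_on {u j..v j}"
          by (intro integrable_add ri) auto
      qed (use ki in \<open>auto simp: r_def\<close>)
      also have "\<dots> = integral {u j..v j} (r M) + real M * (v j - u j)"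
        using ri uv by (subst integral_add) auto
      finally show "norm (F (v j) - F (u j)) \<le> integral {u j..v j} (r M) + real M * (v j - u j)" .
    qed
    also have "\<dots> = (\<Sum>j<n. integral {u j..v j} (r M)) + real M * (\<Sum>j<n. v j - u j)"
      by (simp add: sum.distrib sum_distrib_left)
    also have "(\<Sum>j<n. integral {u j..v j} (r M)) \<le> integral {a..b} (r M)"
      using ri fam by (intro sum_integral_interval_family_le) (auto simp: r_def)
    also have "real M * (\<Sum>j<n. v j - u j) \<le> real (Suc M) * (\<epsilon> / (2 * real (Suc M)))"
      using len interval_familyD[OF fam] by (intro mult_mono sum_nonneg) auto
    also have "\<dots> = \<epsilon> / 2" by (simp del: of_nat_Suc)
    finally show "(\<Sum>j<n. norm (F (v j) - F (u j))) < \<epsilon>"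
      using M by linarith
  qed (use \<open>\<epsilon> > 0\<close> in simp)
qed

section \<open>Linear differential equations with locally integrable coefficients\<close>

text \<open>The oriented integral from 0 to x: for x > 0 the second term, for x < 0 the first, runs
  over an empty interval and is 0.\<close>

definition integral_from_0 :: "(real \<Rightarrow> 'a::euclidean_space) \<Rightarrow> real \<Rightarrow> 'a" where
  "integral_from_0 g x = integral {0..x} g - integral {x..0} g"

lemma integral_from_0_diff:
  assumes int: "\<And>a b. g integrable_on {a..b}" and "x \<le> y"
  shows "integral_from_0 g y - integral_from_0 g x = integral {x..y} g"
proof -
  have *: "integral {0..x} g = 0 \<or> x > 0" "integral {x..0} g = 0 \<or> x < 0" for x
    by (cases "x = 0"; force)+
  note comb = Henstock_Kurzweil_Integration.integral_combine[OF _ _ int]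
  consider "0 \<le> x" | "x < 0" "0 \<le> y" | "y < 0" by linarith
  then show ?thesis
  proof cases
    case 1
    then show ?thesis
      using comb[of 0 x y] *(2)[of x] *(2)[of y] \<open>x \<le> y\<close> by (auto simp: integral_from_0_def algebra_simps)
  next
    case 2
    then show ?thesis
      using comb[of x 0 y] *(1)[of x] *(2)[of y] \<open>x \<le> y\<close> by (auto simp: integral_from_0_def algebra_simps)
  next
    case 3
    then show ?thesis
      using comb[of x y 0] *(1)[of x] *(1)[of y] \<open>x \<le> y\<close> by (auto simp: integral_from_0_def algebra_simps)
  qed
qed

lemma integral_from_0_0 [simp]: "integral_from_0 g 0 = 0"
  by (simp add: integral_from_0_def)

lemma norm_integral_from_0_le:
  fixes g :: "real \<Rightarrow> 'a::euclidean_space" and h :: "real \<Rightarrow> real"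
  assumes "\<And>a b. g integrable_on {a..b}" "\<And>a b. h integrable_on {a..b}" "\<And>x. norm (g x) \<le> h x"
  shows "norm (integral_from_0 g x) \<le> \<bar>integral_from_0 h x\<bar>"
proof -
  have *: "norm (integral {a..b} g) \<le> integral {a..b} h" for a b
    using assms by (intro integral_norm_bound_integral) auto
  have z: "integral {0..x} f = 0 \<or> x > 0" "integral {x..0} f = 0 \<or> x < 0"
    for f :: "real \<Rightarrow> 'z::euclidean_space"
    by (cases "x = 0"; force)+
  show ?thesis
    using *[of 0 x] *[of x 0] z[of g] z[of h]
    by (auto simp: integral_from_0_def)
qed

lemma
  fixes g :: "real \<Rightarrow> 'a::euclidean_space"
  assumes g: "\<And>a b. g absolutely_integrable_on {a..b}"
  shows AC_loc_integral_from_0: "AC_loc (integral_from_0 g)"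
    and AE_integral_from_0_derivative:
      "AE x in lebesgue. (integral_from_0 g has_vector_derivative g x) (at x)"
proof -
  have gi: "g integrable_on {a..b}" for a b
    using g set_lebesgue_integral_eq_integral(1) by blast
  show "AC_loc (integral_from_0 g)"
    using g integral_from_0_diff[OF gi] by (rule AC_loc_indefinite_integral)
  show "AE x in lebesgue. (integral_from_0 g has_vector_derivative g x) (at x)"
    using gi integral_from_0_diff[OF gi] by (rule AE_has_vector_derivative_indefinite_integral)
qed

text \<open>On a compact interval \<open>f\<close> has an upper bound \<open>M\<close>, and exp is
  Lipschitz with constant \<open>exp M\<close> below \<open>M\<close>.\<close>

lemma AC_loc_exp:
  fixes f :: "real \<Rightarrow> real"
  assumes ac: "AC_loc f"
  shows "AC_loc (\<lambda>x. exp (f x))"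
  unfolding AC_loc_def
proof (intro allI)
  fix a b :: real
  have "bounded (f ` {a..b})"
    using ac by (intro compact_imp_bounded compact_continuous_image AC_loc_imp_continuous_on) auto
  then obtain M where M: "\<And>x. x \<in> {a..b} \<Longrightarrow> f x \<le> M"
    unfolding bounded_iff by (force simp: abs_le_iff)
  have lip: "exp v - exp u \<le> exp M * (v - u)" if "u \<le> v" "v \<le> M" for u v :: real
  proof -
    have "1 - exp (u - v) \<le> v - u"
      using exp_ge_add_one_self[of "u - v"] by linarith
    then have "exp v * (1 - exp (u - v)) \<le> exp M * (v - u)"
      using that by (intro mult_mono) auto
    then show ?thesis by (simp add: algebra_simps flip: exp_add)
  qed
  have lip': "\<bar>exp v - exp u\<bar> \<le> exp M * \<bar>v - u\<bar>" if "u \<le> M" "v \<le> M" for u v :: real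
    using lip[of u v] lip[of v u] that by (cases "u \<le> v") auto
  show "absolutely_continuous_on {a..b} (\<lambda>x. exp (f x))"
    using ac[unfolded AC_loc_def, rule_format, of a b]
    by (rule absolutely_continuous_on_dominated[where C = "exp M"]) (auto intro!: lip' M)
qed

lemma absolutely_integrable_continuous_mult:
  fixes f g :: "real \<Rightarrow> real"
  assumes "continuous_on UNIV f" "g absolutely_integrable_on {a..b}"
  shows "(\<lambda>x. f x * g x) absolutely_integrable_on {a..b}"
proof (rule absolutely_integrable_bounded_measurable_product_real)
  have c: "continuous_on {a..b} f" using assms(1) continuous_on_subset by blast
  then show "f \<in> borel_measurable (lebesgue_on {a..b})"
    by (rule continuous_imp_measurable_on_sets_lebesgue) simp
  show "bounded (f ` {a..b})"
    using c by (intro compact_imp_bounded compact_continuous_image) auto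
qed (use assms in auto)

text \<open>Up to sign and a factor 2 the integrand is the derivative of an exponential of
  \<open>Q\<close>, so the integral equals (exp(2|Q x|) - 1)/2 in modulus. The 2 in the exponent is
  the source of the contraction constant 1/2 below.\<close>

lemma exp_weighted_integral_bound:
  fixes k :: "real \<Rightarrow> real"
  assumes k: "\<And>a b. k absolutely_integrable_on {a..b}" "\<And>t. k t \<ge> 0"
  defines "Q \<equiv> integral_from_0 k"
  shows "\<bar>integral_from_0 (\<lambda>t. exp (2 * \<bar>Q t\<bar>) * k t) x\<bar> \<le> exp (2 * \<bar>Q x\<bar>) / 2"
proof -
  have ki: "k integrable_on {a..b}" for a b
    using k(1) set_lebesgue_integral_eq_integral(1) by blast
  have Q: "AC_loc Q" "AE x in lebesgue. (Q has_vector_derivative k x) (at x)"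
    unfolding Q_def using AC_loc_integral_from_0[OF k(1)] AE_integral_from_0_derivative[OF k(1)] by auto
  have mono: "Q u \<le> Q v" if "u \<le> v" for u v
    using integral_from_0_diff[OF ki that] integral_nonneg[OF ki, of u v] k(2) unfolding Q_def by fastforce
  have Q0: "Q 0 = 0" by (simp add: Q_def)
  \<comment> \<open>\<open>s\<close> stands for the sign of \<open>x\<close>: \<open>Q\<close> is
    monotone and vanishes at 0, so |Q t| = s Q t between 0 and x, and no absolute value has to be
    differentiated.\<close>
  have hi: "((\<lambda>t. exp (2 * s * Q t) * (2 * s * k t)) has_integral
      exp (2 * s * Q v) - exp (2 * s * Q u)) {u..v}" if "u \<le> v" for s u v
  proof (rule AC_loc_has_integral[OF _ that])
    have "AC_loc (\<lambda>x. (2 * s) *\<^sub>R Q x)"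
      by (rule AC_loc_linear[OF bounded_linear_scaleR_right Q(1)])
    then show "AC_loc (\<lambda>x. exp (2 * s * Q x))"
      by (intro AC_loc_exp) simp
    show "AE x in lebesgue. ((\<lambda>x. exp (2 * s * Q x)) has_vector_derivative
        exp (2 * s * Q x) * (2 * s * k x)) (at x)"
      using Q(2) unfolding has_real_derivative_iff_has_vector_derivative[symmetric]
      by eventually_elim (auto intro!: derivative_eq_intros)
  qed
  show ?thesis
  proof (cases "x \<ge> 0")
    case True
    have "((\<lambda>t. (exp (2 * 1 * Q t) * (2 * 1 * k t)) / 2) has_integral
        (exp (2 * 1 * Q x) - exp (2 * 1 * Q 0)) / 2) {0..x}"
      by (intro has_integral_divide hi True)
    then have "((\<lambda>t. exp (2 * \<bar>Q t\<bar>) * k t) has_integral (exp (2 * Q x) - 1) / 2) {0..x}"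
      by (rule has_integral_eq_rhs[OF has_integral_eq[rotated]]) (use mono[of 0] Q0 in auto)
    moreover have "integral {x..0} (\<lambda>t. exp (2 * \<bar>Q t\<bar>) * k t) = 0"
      using True by (cases "x = 0") auto
    ultimately have I: "integral_from_0 (\<lambda>t. exp (2 * \<bar>Q t\<bar>) * k t) x = (exp (2 * Q x) - 1) / 2"
      by (simp add: integral_from_0_def integral_unique)
    have "Q x \<ge> 0" using mono[OF True] Q0 by simp
    then have E: "exp (2 * Q x) \<ge> 1" and Qx: "\<bar>Q x\<bar> = Q x" by simp_all
    have "\<bar>(e - 1) / 2\<bar> \<le> e / 2" if "e \<ge> 1" for e :: real using that by (simp add: abs_le_iff)
    from this[OF E] show ?thesis unfolding I Qx .
  next
    case False
    have "((\<lambda>t. - (exp (2 * -1 * Q t) * (2 * -1 * k t)) / 2) has_integral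
        - (exp (2 * -1 * Q 0) - exp (2 * -1 * Q x)) / 2) {x..0}"
      by (intro has_integral_divide has_integral_neg hi) (use False in auto)
    then have "((\<lambda>t. exp (2 * \<bar>Q t\<bar>) * k t) has_integral (exp (2 * - Q x) - 1) / 2) {x..0}"
      by (rule has_integral_eq_rhs[OF has_integral_eq[rotated]]) (use mono[of _ 0] Q0 in auto)
    then have "integral_from_0 (\<lambda>t. exp (2 * \<bar>Q t\<bar>) * k t) x = - ((exp (2 * - Q x) - 1) / 2)"
      using False by (simp add: integral_from_0_def integral_unique)
    then show ?thesis using mono[of x 0] False Q0 by simp
  qed
qed

text \<open>In the norm \<open>sup e\<^sup>-\<^sup>2\<^sup>|\<^sup>Q\<^sup>|\<bar>U\<bar>\<close> with \<open>Q(x) = \<integral>\<^sub>0\<^sup>x k\<close>, the integral operator is a contraction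
  on all of the real line at once, so no local solutions have to be glued.\<close>
theorem linear_ode_solution_exists:
  fixes A :: "real \<Rightarrow> 'a::euclidean_space \<Rightarrow> 'a"
  assumes lin: "\<And>t. linear (A t)"
    and int: "\<And>u a b. continuous_on UNIV u \<Longrightarrow> (\<lambda>t. A t (u t)) absolutely_integrable_on {a..b}"
    and k: "\<And>a b. k absolutely_integrable_on {a..b}" "\<And>t. k t \<ge> 0"
    and bound: "\<And>t u. norm (A t u) \<le> k t * norm u"
  obtains U where "AC_loc U" "U 0 = c"
    "AE x in lebesgue. (U has_vector_derivative A x (U x)) (at x)"
proof -
  define Q where "Q = integral_from_0 k"
  define W where "W x = exp (2 * \<bar>Q x\<bar>)" for x
  have "AC_loc Q" unfolding Q_def by (rule AC_loc_integral_from_0[OF k(1)])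
  then have "continuous_on UNIV Q" by (rule AC_loc_imp_continuous_on)
  then have Wcont: "continuous_on UNIV W"
    unfolding W_def by (intro continuous_intros)
  have Wpos: "W x \<ge> 1" for x by (simp add: W_def)
  have Wk: "(\<lambda>t. B * (W t * k t)) integrable_on {a..b}" for a b B
    using integrable_cmul[OF set_lebesgue_integral_eq_integral(1)
        [OF absolutely_integrable_continuous_mult[OF Wcont k(1)]], where c = B] by simp
  have scale: "integral_from_0 (\<lambda>t. B * (W t * k t)) x = B * integral_from_0 (\<lambda>t. W t * k t) x" for B x
    by (simp add: integral_from_0_def right_diff_distrib)
  have int': "(\<lambda>t. A t (u t)) integrable_on {a..b}" if "continuous_on UNIV u" for u a b
    using int[OF that] set_lebesgue_integral_eq_integral(1) by blast
  \<comment> \<open>Used twice: applied to \<open>V\<close> it shows that \<open>T V\<close> is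
    bounded, applied to a difference of two functions it gives the Lipschitz constant 1/2.\<close>
  have est: "norm (integral_from_0 (\<lambda>t. A t (W t *\<^sub>R v t)) x) \<le> B * W x / 2"
    if v: "continuous_on UNIV v" "\<And>x. norm (v x) \<le> B" for v B x
  proof -
    have "norm (integral_from_0 (\<lambda>t. A t (W t *\<^sub>R v t)) x) \<le> \<bar>integral_from_0 (\<lambda>t. B * (W t * k t)) x\<bar>"
    proof (rule norm_integral_from_0_le)
      show "(\<lambda>t. A t (W t *\<^sub>R v t)) integrable_on {a..b}" for a b
        by (intro int' continuous_intros Wcont v)
      show "norm (A t (W t *\<^sub>R v t)) \<le> B * (W t * k t)" for t
      proof -
        have "norm (A t (W t *\<^sub>R v t)) \<le> k t * norm (W t *\<^sub>R v t)" by (rule bound)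
        also have "\<dots> \<le> k t * (W t * B)"
          using Wpos[of t] k(2) v(2) by (intro mult_left_mono) (auto intro!: mult_left_mono)
        finally show ?thesis by (simp add: mult_ac)
      qed
    qed (rule Wk)
    also have "\<dots> = B * \<bar>integral_from_0 (\<lambda>t. W t * k t) x\<bar>"
      using order_trans[OF norm_ge_zero v(2)] unfolding scale by (simp add: abs_mult)
    also have "\<dots> \<le> B * (W x / 2)"
      using order_trans[OF norm_ge_zero v(2)] exp_weighted_integral_bound[OF k, of x]
      unfolding W_def Q_def by (intro mult_left_mono) auto
    finally show ?thesis by simp
  qed
  have icont: "continuous_on UNIV (integral_from_0 (\<lambda>t. A t (W t *\<^sub>R v t)))"
    if v: "continuous_on UNIV v" for v
    by (intro AC_loc_imp_continuous_on AC_loc_integral_from_0 int continuous_intros Wcont v)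
  \<comment> \<open>The unknown is V = U / W. This turns the weighted norm into the supremum norm on
    the complete space of bounded continuous functions, where \<open>banach_fix_type\<close>
    applies.\<close>
  define T where "T V = (\<lambda>x. (c + integral_from_0 (\<lambda>t. A t (W t *\<^sub>R apply_bcontfun V t)) x) /\<^sub>R W x)"
    for V :: "real \<Rightarrow>\<^sub>C 'a"
  have T: "T V \<in> bcontfun" for V
  proof (rule bcontfun_normI)
    have "W x \<noteq> 0" for x using Wpos[of x] by auto
    then show "continuous_on UNIV (T V)"
      unfolding T_def by (intro continuous_intros Wcont icont) auto
    show "norm (T V x) \<le> norm c + norm V / 2" for x
    proof -
      have "norm (c + integral_from_0 (\<lambda>t. A t (W t *\<^sub>R apply_bcontfun V t)) x) \<le> norm c + norm V * W x / 2"
        by (intro norm_triangle_le add_left_mono est norm_bounded) auto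
      also have "\<dots> \<le> norm c * W x + norm V * W x / 2"
        using Wpos[of x] mult_left_mono[of 1 "W x" "norm c"] by simp
      also have "\<dots> = (norm c + norm V / 2) * W x"
        by (simp add: algebra_simps)
      finally have "norm (c + integral_from_0 (\<lambda>t. A t (W t *\<^sub>R apply_bcontfun V t)) x) / W x
          \<le> norm c + norm V / 2"
        using Wpos[of x] by (subst pos_divide_le_eq) auto
      moreover have "\<bar>inverse (W x)\<bar> = inverse (W x)" using Wpos[of x] by simp
      ultimately show ?thesis
        unfolding T_def norm_scaleR by (simp only: divide_inverse_commute)
    qed
  qed
  have "\<exists>!V. Bcontfun (T V) = V"
  proof (rule banach_fix_type[of "1 / 2"])
    show "\<forall>V V'. dist (Bcontfun (T V)) (Bcontfun (T V')) \<le> 1 / 2 * dist V V'"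
    proof (intro allI dist_bound)
      fix V V' :: "real \<Rightarrow>\<^sub>C 'a" and x
      let ?I = "\<lambda>V. integral_from_0 (\<lambda>t. A t (W t *\<^sub>R apply_bcontfun V t)) x"
      have ii: "(\<lambda>t. A t (W t *\<^sub>R apply_bcontfun V t)) integrable_on {a..b}" for V a b
        by (intro int' continuous_intros Wcont) auto
      have "?I V - ?I V' = integral_from_0 (\<lambda>t. A t (W t *\<^sub>R (apply_bcontfun V t - apply_bcontfun V' t))) x"
        unfolding integral_from_0_def scaleR_diff_right linear_diff[OF lin]
        using ii by (simp add: integral_diff)
      also have "norm \<dots> \<le> dist V V' * W x / 2"
        by (intro est continuous_intros) (auto simp flip: dist_norm intro: dist_bounded)
      finally have "norm (?I V - ?I V') \<le> dist V V' * W x / 2" .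
      moreover have "T V x - T V' x = (?I V - ?I V') /\<^sub>R W x"
        by (simp add: T_def algebra_simps)
      moreover have "inverse (W x) \<ge> 0" "inverse (W x) * W x = 1" using Wpos[of x] by simp_all
      ultimately have "norm (T V x - T V' x) \<le> inverse (W x) * (dist V V' * W x / 2)"
        by (simp only: norm_scaleR abs_of_nonneg mult_left_mono)
      also have "\<dots> = 1 / 2 * dist V V'"
        using \<open>inverse (W x) * W x = 1\<close> by (simp add: algebra_simps del: left_inverse)
      finally have "norm (T V x - T V' x) \<le> 1 / 2 * dist V V'" .
      then show "dist (apply_bcontfun (Bcontfun (T V)) x) (apply_bcontfun (Bcontfun (T V')) x) \<le> 1 / 2 * dist V V'"
        by (simp add: Bcontfun_inverse[OF T] dist_norm)
    qed
  qed auto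
  then obtain V where "Bcontfun (T V) = V" by blast
  then have V: "apply_bcontfun V x = T V x" for x
    by (metis Bcontfun_inverse T)
  define U where "U x = W x *\<^sub>R apply_bcontfun V x" for x
  have U: "U x = c + integral_from_0 (\<lambda>t. A t (U t)) x" for x
    unfolding U_def by (subst V) (use Wpos[of x] in \<open>simp add: T_def\<close>)
  have "continuous_on UNIV U"
    unfolding U_def by (intro continuous_intros Wcont) auto
  note AU = int[OF this]
  show thesis
  proof (rule that[of U])
    have eq: "U = (\<lambda>x. c + integral_from_0 (\<lambda>t. A t (U t)) x)" using U by blast
    have "AC_loc (\<lambda>x. c + integral_from_0 (\<lambda>t. A t (U t)) x)"
      using AC_loc_integral_from_0[OF AU] unfolding AC_loc_def
      by (intro allI absolutely_continuous_on_add absolutely_continuous_on_const) blast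
    then show "AC_loc U" by (simp flip: eq)
    show "U 0 = c" by (subst U) simp
    have "AE x in lebesgue. ((\<lambda>x. c + integral_from_0 (\<lambda>t. A t (U t)) x) has_vector_derivative A x (U x)) (at x)"
      using AE_integral_from_0_derivative[OF AU]
      by eventually_elim (auto intro!: derivative_eq_intros)
    then show "AE x in lebesgue. (U has_vector_derivative A x (U x)) (at x)" by (simp flip: eq)
  qed
qed

section \<open>Intermediate derivatives in \<open>L\<^sup>2\<close>\<close>

lemma L2_D:
  fixes f :: "real \<Rightarrow> 'a::euclidean_space"
  assumes "L2 f"
  shows "(\<lambda>x. (norm (f x))\<^sup>2) integrable_on UNIV" "(\<lambda>x. (norm (f x))\<^sup>2) integrable_on {a..b}"
    "f absolutely_integrable_on {a..b}"
proof -
  show *: "(\<lambda>x. (norm (f x))\<^sup>2) integrable_on UNIV"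
    using assms unfolding L2_def by (intro integrable_on_lebesgue) auto
  show **: "(\<lambda>x. (norm (f x))\<^sup>2) integrable_on {a..b}" for a b
    by (rule integrable_on_subinterval[OF *]) simp
  show "f absolutely_integrable_on {a..b}"
  proof (rule measurable_bounded_by_integrable_imp_absolutely_integrable)
    show "f \<in> borel_measurable (lebesgue_on {a..b})"
      using assms unfolding L2_def by (intro measurable_restrict_space1) auto
    show "(\<lambda>x. 1 + (norm (f x))\<^sup>2) integrable_on {a..b}"
      by (intro integrable_add **) auto
    show "norm (f x) \<le> 1 + (norm (f x))\<^sup>2" for x
    proof -
      have "0 \<le> (norm (f x) - 1)\<^sup>2" by simp
      then have "2 * norm (f x) \<le> (norm (f x))\<^sup>2 + 1" by (simp add: power2_diff)
      moreover have "0 \<le> norm (f x)" by simp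
      ultimately show ?thesis by linarith
    qed
  qed simp
qed

text \<open>Cauchy-Schwarz, from integrating the square of k - s, where s is the integral of k.
  Because the interval has length 1, \<open>s\<close> is also the mean of k.\<close>

lemma square_integral_le_unit_interval:
  fixes k :: "real \<Rightarrow> real"
  assumes k: "k integrable_on {x..x+1}" "(\<lambda>t. (k t)\<^sup>2) integrable_on {x..x+1}"
  shows "(integral {x..x+1} k)\<^sup>2 \<le> integral {x..x+1} (\<lambda>t. (k t)\<^sup>2)"
proof -
  define s where "s = integral {x..x+1} k"
  have hi: "((\<lambda>t. (k t)\<^sup>2 - (2 * s) *\<^sub>R k t + s\<^sup>2) has_integral
      integral {x..x+1} (\<lambda>t. (k t)\<^sup>2) - (2 * s) *\<^sub>R s + (x + 1 - x) *\<^sub>R s\<^sup>2) {x..x+1}"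
    unfolding s_def
    by (intro has_integral_add has_integral_diff has_integral_cmul integrable_integral k has_integral_const_real[THEN has_integral_eq_rhs]) auto
  have eq: "(k t)\<^sup>2 - (2 * s) *\<^sub>R k t + s\<^sup>2 = (k t - s)\<^sup>2" for t
    by (simp add: power2_diff)
  have "0 \<le> integral {x..x+1} (\<lambda>t. (k t)\<^sup>2) - (2 * s) *\<^sub>R s + (x + 1 - x) *\<^sub>R s\<^sup>2"
    by (rule has_integral_nonneg[OF hi]) (simp only: eq zero_le_power2)
  then show ?thesis
    by (simp add: s_def power2_eq_square)
qed

text \<open>Comparing \<open>g x\<close> with its mean over \<open>[x, x+1]\<close>, which is \<open>f (x+1) - f x\<close>, bounds
  \<open>\<bar>g x\<bar>\<^sup>2\<close> by shifts of \<open>\<bar>f\<bar>\<^sup>2\<close> and the increment \<open>S (x+1) - S x\<close> of \<open>S = \<integral> \<bar>h\<bar>\<^sup>2\<close>;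
  the integral of the latter telescopes.\<close>
theorem L2_intermediate_derivative:
  fixes f g h :: "real \<Rightarrow> 'a::euclidean_space"
  assumes f: "AC_loc f" and g: "AC_loc g"
    and f': "AE x in lebesgue. (f has_vector_derivative g x) (at x)"
    and g': "AE x in lebesgue. (g has_vector_derivative h x) (at x)"
    and L2: "L2 f" "L2 h"
  shows "L2 g"
proof -
  define H where "H x = (norm (h x))\<^sup>2" for x
  have H: "H integrable_on UNIV" "H integrable_on {a..b}" "H x \<ge> 0" for a b x
    using L2_D[OF L2(2)] by (auto simp: H_def[abs_def])
  have Habs: "H absolutely_integrable_on {a..b}" for a b
    using H by (intro nonnegative_absolutely_integrable_1) auto
  define k where "k x = norm (h x)" for x
  have hi: "h integrable_on {a..b}" for a b
    using L2_D(3)[OF L2(2)] set_lebesgue_integral_eq_integral(1) by blast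
  have ki: "k integrable_on {a..b}" for a b
    using absolutely_integrable_norm[OF L2_D(3)[OF L2(2)], of a b] set_lebesgue_integral_eq_integral(1)
    unfolding k_def o_def by blast
  define S where "S = integral_from_0 H"
  have S: "S y - S x = integral {x..y} H" if "x \<le> y" for x y
    unfolding S_def by (rule integral_from_0_diff[OF H(2) that])
  have "AC_loc S" unfolding S_def by (rule AC_loc_integral_from_0[OF Habs])
  then have Scont: "continuous_on T S" for T by (rule AC_loc_imp_continuous_on)
  have Smono: "S x \<le> S y" if "x \<le> y" for x y
    using S[OF that] integral_nonneg[OF H(2), of x y] H(3) by fastforce
  have Sbound: "S y - S x \<le> integral UNIV H" if "x \<le> y" for x y
    unfolding S[OF that] using H by (intro integral_subset_le) auto
  have fcont: "continuous_on T f" and gcont: "continuous_on T g" for T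
    using f g by (auto intro: AC_loc_imp_continuous_on)
  define F where "F x = (norm (f x))\<^sup>2" for x
  have Fi: "F integrable_on UNIV" using L2_D(1)[OF L2(1)] by (simp add: F_def[abs_def])
  have Fcont: "continuous_on T F" for T unfolding F_def by (intro continuous_intros fcont)
  have Fbound: "integral {a..b} F \<le> integral UNIV F" for a b
    using Fi integrable_on_subinterval[OF Fi] by (intro integral_subset_le) (auto simp: F_def)
  \<comment> \<open>Three terms arise: f at both ends of [x, x+1] through the mean of g, and the
    deviation of g from g x there, at most the integral \<open>s\<close> of the norm of h. The
    factor 3 is that of (a+b+c)^2 \<le> 3(a^2+b^2+c^2).\<close>
  have pointwise: "(norm (g x))\<^sup>2 \<le> 3 * (F (x + 1) + F x + (S (x + 1) - S x))" for x
  proof -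
    define s where "s = integral {x..x+1} k"
    have var: "norm (g t - g x) \<le> s" if "t \<in> {x..x+1}" for t
    proof -
      have "(h has_integral g t - g x) {x..t}"
        using AC_loc_has_integral[OF g _ g'] that by simp
      then have "norm (g t - g x) \<le> integral {x..t} k"
        using integral_norm_bound_integral[OF hi ki, of x t] by (auto simp: k_def dest: integral_unique)
      also have "\<dots> \<le> s"
        unfolding s_def using that ki by (intro integral_subset_le) (auto simp: k_def)
      finally show ?thesis .
    qed
    have "(g has_integral f (x + 1) - f x) {x..x+1}"
      using AC_loc_has_integral[OF f _ f'] by simp
    from has_integral_diff[OF this has_integral_const_real[of "g x" x "x + 1"]]
    have mean: "((\<lambda>t. g t - g x) has_integral f (x + 1) - f x - g x) {x..x+1}" by simp
    have "norm (f (x + 1) - f x - g x) \<le> s * Henstock_Kurzweil_Integration.content {x..x+1}"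
    proof (rule has_integral_bound_real[OF _ finite.emptyI mean])
      show "0 \<le> s" using var[of x] by simp
    qed (use var in blast)
    then have "norm (f (x + 1) - f x - g x) \<le> s" by simp
    then have "norm (g x) \<le> norm (f (x + 1)) + norm (f x) + s"
      using norm_triangle_ineq4[of "f (x + 1) - f x" "f (x + 1) - f x - g x"]
        norm_triangle_ineq4[of "f (x + 1)" "f x"] by simp
    then have "(norm (g x))\<^sup>2 \<le> (norm (f (x + 1)) + norm (f x) + s)\<^sup>2"
      by (intro power_mono) auto
    also have "\<dots> \<le> 3 * ((norm (f (x + 1)))\<^sup>2 + (norm (f x))\<^sup>2 + s\<^sup>2)"
    proof -
      have "(a + b + c)\<^sup>2 \<le> 3 * (a\<^sup>2 + b\<^sup>2 + c\<^sup>2)" for a b c :: real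
        using zero_le_power2[of "a - b"] zero_le_power2[of "b - c"] zero_le_power2[of "a - c"]
        by (simp add: power2_eq_square algebra_simps)
      then show ?thesis .
    qed
    also have "s\<^sup>2 \<le> S (x + 1) - S x"
      using square_integral_le_unit_interval[OF ki, of x] H(2)[of x "x + 1"] S[of x "x + 1"]
      unfolding s_def k_def H_def[abs_def] by simp
    finally show ?thesis by (simp add: F_def)
  qed
  \<comment> \<open>Two integrals of \<open>F\<close> come from f and its shift, one of
    \<open>H\<close> from the telescoped increments of \<open>S\<close>; nothing depends on the
    window size n.\<close>
  define C where "C = 3 * (2 * integral UNIV F + integral UNIV H)"
  have shift: "((\<lambda>x. \<phi> (x + 1)) has_integral integral {a+1..b+1} \<phi>) {a..b}"
    if "\<And>T. continuous_on T \<phi>" for \<phi> :: "real \<Rightarrow> real" and a b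
  proof -
    have "(\<lambda>x. \<phi> (x + 1)) integrable_on {a..b}"
      by (intro integrable_continuous_real continuous_on_compose2[OF that[of UNIV]] continuous_intros) auto
    moreover have "integral {a..b} (\<lambda>x. \<phi> (x + 1)) = integral {a+1..b+1} \<phi>"
      using integral_shift[of a 1 b \<phi>] that by (simp add: o_def)
    ultimately show ?thesis by (metis integrable_integral)
  qed
  have bound: "integral {-real n..real n} (\<lambda>x. (norm (g x))\<^sup>2) \<le> C" for n
  proof -
    let ?I = "{-real n..real n}"
    \<comment> \<open>After cancellation one unit interval remains at each end, so the difference is
      at most the rise of the monotone \<open>S\<close> from -n to n + 1.\<close>
    have Ssum: "integral {-real n+1..real n+1} S - integral ?I S \<le> integral UNIV H"
    proof -
      have i: "S integrable_on {a..b}" for a b by (rule integrable_continuous_real[OF Scont])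
      have *: "integral {-real n+1..real n+1} S - integral ?I S =
          integral {real n..real n+1} S - integral {-real n..-real n+1} S"
      \<comment> \<open>For n = 0 both sides vanish; for n \<ge> 1 the point -n + 1 does not exceed
        n, so integrals may be split there.\<close>
      proof (cases "n = 0")
        case False
        then have "-real n + 1 \<le> real n" by linarith
        then show ?thesis
          using Henstock_Kurzweil_Integration.integral_combine[of "-real n + 1" "real n" "real n + 1" S]
            Henstock_Kurzweil_Integration.integral_combine[of "-real n" "-real n + 1" "real n" S] i by simp
      qed simp
      have "integral {real n..real n+1} S \<le> integral {real n..real n+1} (\<lambda>_. S (real n + 1))"
        by (intro integral_le i) (auto intro: Smono)
      moreover have "integral {-real n..-real n+1} (\<lambda>_. S (- real n)) \<le> integral {-real n..-real n+1} S"
        by (intro integral_le i) (auto intro: Smono)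
      ultimately have "integral {real n..real n+1} S - integral {-real n..-real n+1} S \<le> S (real n + 1) - S (- real n)"
        by simp
      also have "\<dots> \<le> integral UNIV H" by (rule Sbound) simp
      finally show ?thesis using * by simp
    qed
    have "((\<lambda>x. 3 * (F (x + 1) + F x + (S (x + 1) - S x))) has_integral
        3 * (integral {-real n+1..real n+1} F + integral ?I F +
          (integral {-real n+1..real n+1} S - integral ?I S))) ?I"
      by (intro has_integral_mult_right has_integral_add has_integral_diff shift Fcont Scont
          integrable_integral integrable_continuous_real)
    moreover have "((\<lambda>x. (norm (g x))\<^sup>2) has_integral integral ?I (\<lambda>x. (norm (g x))\<^sup>2)) ?I"
      by (intro integrable_integral integrable_continuous_real continuous_intros gcont)
    ultimately have "integral ?I (\<lambda>x. (norm (g x))\<^sup>2) \<le> 3 * (integral {-real n+1..real n+1} F + integral ?I F +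
          (integral {-real n+1..real n+1} S - integral ?I S))"
      using pointwise by (rule_tac has_integral_le) auto
    also have "\<dots> \<le> C"
      unfolding C_def using Ssum Fbound[of "-real n+1" "real n+1"] Fbound[of "-real n" "real n"] by simp
    finally show ?thesis .
  qed
  let ?G = "\<lambda>n x. if x \<in> {-real n..real n} then (norm (g x))\<^sup>2 else 0"
  have Gi: "integral UNIV (?G n) = integral {-real n..real n} (\<lambda>x. (norm (g x))\<^sup>2)" for n
    by (rule integral_restrict_UNIV)
  have "(\<lambda>x. (norm (g x))\<^sup>2) integrable_on UNIV"
  proof (rule monotone_convergence_increasing[THEN conjunct1])
    show "?G n integrable_on UNIV" for n
      unfolding integrable_restrict_UNIV
      by (intro integrable_continuous_real continuous_intros gcont)
    show "?G n x \<le> ?G (Suc n) x" for n x by auto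
    show "(\<lambda>n. ?G n x) \<longlonglongrightarrow> (norm (g x))\<^sup>2" for x
    proof (rule tendsto_eventually)
      obtain n0 where "\<bar>x\<bar> \<le> real n0" using real_arch_simple by blast
      then show "\<forall>\<^sub>F n in sequentially. ?G n x = (norm (g x))\<^sup>2"
        unfolding eventually_sequentially by (intro exI[of _ n0]) auto
    qed
    have "0 \<le> integral {-real n..real n} (\<lambda>x. (norm (g x))\<^sup>2)" for n
      by (intro integral_nonneg integrable_continuous_real continuous_intros gcont) auto
    then show "bounded (range (\<lambda>n. integral UNIV (?G n)))"
      unfolding Gi using bound by (intro boundedI[of _ C]) auto
  qed
  then have "(\<lambda>x. (norm (g x))\<^sup>2) absolutely_integrable_on UNIV"
    by (rule nonnegative_absolutely_integrable_1) auto
  moreover have "g \<in> borel_measurable lebesgue"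
    by (intro measurable_completion) (simp add: borel_measurable_continuous_onI gcont)
  ultimately show ?thesis
    by (simp add: L2_def set_integrable_def)
qed

section \<open>The unitary fundamental matrix\<close>

lemma bounded_bilinear_matrix_mult: "bounded_bilinear ((**) :: complex^2^2 \<Rightarrow> complex^2^2 \<Rightarrow> complex^2^2)"
  unfolding bilinear_conv_bounded_bilinear[symmetric] bilinear_def
  by (intro conjI allI linearI)
    (simp_all add: vec_eq_iff matrix_matrix_mult_def sum_2 algebra_simps)

lemma bounded_bilinear_matrix_vector_mult: "bounded_bilinear ((*v) :: complex^2^2 \<Rightarrow> complex^2 \<Rightarrow> complex^2)"
  unfolding bilinear_conv_bounded_bilinear[symmetric] bilinear_def
  by (intro conjI allI linearI)
    (simp_all add: vec_eq_iff matrix_vector_mult_def sum_2 algebra_simps)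

lemma bounded_linear_adjoint_mat: "bounded_linear adjoint_mat"
  unfolding linear_conv_bounded_linear[symmetric]
  by (intro linearI) (simp_all add: vec_eq_iff adjoint_mat_def)

lemma norm_vector_smult: "norm (c *s (v :: complex^'n)) = norm c * norm v"
  by (simp add: norm_vec_def norm_mult L2_set_right_distrib)

lemma bounded_linear_vector_smult: "bounded_linear (\<lambda>v :: complex^2. c *s v)"
  unfolding linear_conv_bounded_linear[symmetric]
  by (intro linearI) (simp_all add: vec_eq_iff algebra_simps)

section \<open>The reflection diag(1, -1) and the differential expressions\<close>

definition negate_snd :: "complex^2 \<Rightarrow> complex^2" where
  "negate_snd v = vector [v $ 1, - v $ 2]"

lemma negate_snd_nth [simp]: "negate_snd v $ 1 = v $ 1" "negate_snd v $ 2 = - v $ 2"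
  by (simp_all add: negate_snd_def)

lemma negate_snd_idem [simp]: "negate_snd (negate_snd v) = v"
  by (simp add: vec_eq_iff forall_2)

lemma norm_negate_snd [simp]: "norm (negate_snd v) = norm v"
  by (simp add: norm_vec_def L2_set_def sum_2)

lemma bounded_linear_negate_snd: "bounded_linear negate_snd"
  unfolding linear_conv_bounded_linear[symmetric]
  by (intro linearI) (simp_all add: vec_eq_iff forall_2)

lemma vd_eqI: "(f has_vector_derivative f') (at x) \<Longrightarrow> vd f x = f'"
  unfolding vd_def by (rule vector_derivative_at)

lemma coeff_mat_mult_vector: "coeff_mat q x *v v = vector [q x * v $ 2, - cnj (q x) * v $ 1]"
  by (simp add: vec_eq_iff forall_2 matrix_vector_mult_def sum_2 coeff_mat_def)

text \<open>\<open>Nexp\<close> differentiates the two coordinates separately; where the vector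
  function is differentiable, this is the system form to which product rules apply.\<close>

lemma Nexp_eq:
  assumes F: "(F has_vector_derivative F') (at x)"
  shows "Nexp q F x = \<i> *s (F' - coeff_mat q x *v F x)"
proof -
  have "vd (\<lambda>t. F t $ i) x = F' $ i" for i
    by (intro vd_eqI bounded_linear.has_vector_derivative[OF bounded_linear_vec_nth F])
  then show ?thesis
    by (simp add: Nexp_def coeff_mat_mult_vector vec_eq_iff forall_2 algebra_simps)
qed

lemma Mexp_eq_negate_snd_Nexp: "Mexp q F x = negate_snd (Nexp q F x)"
  by (simp add: Mexp_def Nexp_def vec_eq_iff forall_2 algebra_simps)

text \<open>Here the reflection stands inside \<open>vd\<close>, whose value at a point without
  derivative is an arbitrary choice that need not commute with negation. In
  \<open>Mexp_eq_negate_snd_Nexp\<close> it stands outside, so that identity holds at every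
  point.\<close>

lemma Mexp_uminus_negate_snd:
  assumes H: "(H has_vector_derivative H') (at x)"
  shows "Mexp (\<lambda>t. - q t) (\<lambda>t. negate_snd (H t)) x = Nexp q H x"
  unfolding Mexp_eq_negate_snd_Nexp Nexp_eq[OF H]
    Nexp_eq[OF bounded_linear.has_vector_derivative[OF bounded_linear_negate_snd H]]
  by (simp add: vec_eq_iff forall_2 coeff_mat_mult_vector algebra_simps)

lemma AE_Mexp_uminus_negate_snd:
  assumes "AC_loc H"
  shows "AE x in lebesgue. Mexp (\<lambda>t. - q t) (\<lambda>t. negate_snd (H t)) x = Nexp q H x"
  using AC_loc_AE_differentiable[OF assms] by eventually_elim (rule Mexp_uminus_negate_snd)

text \<open>A nonempty open set is not negligible. This promotes a.e. identities between absolutely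
  continuous representatives to identities of functions, which may then be differentiated.\<close>

lemma continuous_AE_eq_imp_eq:
  fixes f g :: "real \<Rightarrow> 'a::euclidean_space"
  assumes "continuous_on UNIV f" "continuous_on UNIV g" and ae: "AE x in lebesgue. f x = g x"
  shows "f = g"
proof -
  have "open {x. f x \<noteq> g x}" by (rule open_Collect_neq) fact+
  moreover have "negligible {x. f x \<noteq> g x}"
    using ae unfolding eventually_ae_filter_negligible by (auto intro: negligible_subset)
  ultimately have "{x. f x \<noteq> g x} = {}" by (metis open_not_negligible)
  then show ?thesis by auto
qed

lemma AC_loc_bilinear:
  "bounded_bilinear p \<Longrightarrow> AC_loc f \<Longrightarrow> AC_loc g \<Longrightarrow> AC_loc (\<lambda>x. p (f x) (g x))"
  unfolding AC_loc_def by (blast intro: absolutely_continuous_on_bilinear)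

section \<open>Square-integrability under a.e. changes and isometries\<close>

lemma L2_cong_AE:
  fixes f g :: "real \<Rightarrow> 'a::euclidean_space"
  assumes f: "L2 f" and ae: "AE x in lebesgue. f x = g x"
  shows "L2 g"
proof -
  have g: "g \<in> borel_measurable lebesgue"
    using f ae unfolding L2_def by (blast intro: borel_measurable_AE)
  have "integrable lebesgue (\<lambda>x. (norm (f x))\<^sup>2)" using f by (simp add: L2_def)
  then have "integrable lebesgue (\<lambda>x. (norm (g x))\<^sup>2)"
  proof (rule integrable_cong_AE_imp)
    show "(\<lambda>x. (norm (g x))\<^sup>2) \<in> borel_measurable lebesgue" using g by measurable
    show "AE x in lebesgue. (norm (f x))\<^sup>2 = (norm (g x))\<^sup>2" using ae by eventually_elim simp
  qed
  with g show ?thesis by (simp add: L2_def)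
qed

lemma L2_isometry:
  fixes T :: "'a::euclidean_space \<Rightarrow> 'b::euclidean_space"
  assumes "bounded_linear T" "\<And>v. norm (T v) = norm v" "L2 f"
  shows "L2 (\<lambda>x. T (f x))"
  using assms unfolding L2_def
  by (auto intro!: borel_measurable_continuous_on[of T] linear_continuous_on)


section \<open>Unitary 2x2 matrices\<close>

lemma norm_unitary_mult:
  assumes "unitary_mat A"
  shows "norm (A *v v) = norm v"
proof -
  have sq: "of_real ((norm w)\<^sup>2) = cnj (w $ 1) * w $ 1 + cnj (w $ 2) * w $ 2" for w :: "complex^2"
    by (simp add: norm_vec_def L2_set_def sum_2 mult.commute[of "cnj _"] flip: complex_norm_square)
  \<comment> \<open>The Gram matrix of the columns of \<open>A\<close>: unitarity makes it the
    identity, and the squared norm of \<open>A *v v\<close> is its quadratic form at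
    \<open>v\<close>.\<close>
  define E where "E i j = cnj (A $ 1 $ i) * A $ 1 $ j + cnj (A $ 2 $ i) * A $ 2 $ j" for i j :: 2
  have E: "E i j = (if i = j then 1 else 0)" for i j
  proof -
    have "E i j = (adjoint_mat A ** A) $ i $ j"
      by (simp add: E_def adjoint_mat_def matrix_matrix_mult_def sum_2)
    then show ?thesis using assms by (simp add: unitary_mat_def mat_def)
  qed
  have "of_real ((norm (A *v v))\<^sup>2) =
      cnj (v $ 1) * v $ 1 * E 1 1 + cnj (v $ 1) * v $ 2 * E 1 2 +
      cnj (v $ 2) * v $ 1 * E 2 1 + cnj (v $ 2) * v $ 2 * E 2 2"
    unfolding sq E_def by (simp add: matrix_vector_mult_def sum_2 algebra_simps)
  also have "\<dots> = of_real ((norm v)\<^sup>2)"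
    by (simp add: E sq del: of_real_power)
  finally have "(norm (A *v v))\<^sup>2 = (norm v)\<^sup>2"
    unfolding of_real_eq_iff .
  then show ?thesis by simp
qed

lemma unitary_mat_adjoint:
  assumes "unitary_mat A"
  shows "unitary_mat (adjoint_mat A)" "adjoint_mat A *v (A *v v) = v" "A *v (adjoint_mat A *v v) = v"
proof -
  have "adjoint_mat (adjoint_mat A) = A" by (simp add: vec_eq_iff adjoint_mat_def)
  then show "unitary_mat (adjoint_mat A)" using assms by (simp add: unitary_mat_def)
  show "adjoint_mat A *v (A *v v) = v" "A *v (adjoint_mat A *v v) = v"
    using assms by (simp_all add: unitary_mat_def matrix_vector_mul_assoc)
qed

text \<open>\<open>matrix_inv\<close> is a choice; the witness \<open>adjoint_mat A\<close> shows
  that the chosen matrix is an inverse, and inverses are unique.\<close>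

lemma matrix_inv_unitary:
  assumes "unitary_mat A"
  shows "matrix_inv A = adjoint_mat A"
proof -
  have "A ** matrix_inv A = mat 1 \<and> matrix_inv A ** A = mat 1"
    unfolding matrix_inv_def by (rule someI[of _ "adjoint_mat A"]) (use assms in \<open>simp add: unitary_mat_def\<close>)
  then have "adjoint_mat A ** (A ** matrix_inv A) = adjoint_mat A" by simp
  then show ?thesis using assms by (simp add: matrix_mul_assoc unitary_mat_def)
qed

text \<open>The entry is a coordinate of the image of a unit vector.\<close>

lemma norm_unitary_entry_le:
  assumes "unitary_mat A"
  shows "norm (A $ i $ j) \<le> 1"
proof -
  have "A $ i $ j = (A *v axis j 1) $ i"
    by (simp add: matrix_vector_mult_def axis_def if_distrib cong: if_cong)
  also have "norm \<dots> \<le> norm (A *v axis j 1)" by (rule Finite_Cartesian_Product.norm_nth_le)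
  also have "\<dots> = 1" 
  proof -
    have "(\<Sum>i\<in>UNIV. (norm ((axis j 1 :: complex^2) $ i))\<^sup>2) = (\<Sum>i\<in>UNIV. if i = j then 1 else 0)"
      by (rule sum.cong) (auto simp: axis_def)
    then have "norm (axis j 1 :: complex^2) = 1"
      by (simp add: norm_vec_def L2_set_def)
    then show ?thesis by (simp add: norm_unitary_mult[OF assms])
  qed
  finally show ?thesis .
qed

section \<open>Existence of the fundamental matrix\<close>

lemma is_Uq_exists:
  assumes q: "L1_loc q"
  shows "\<exists>U. is_Uq q U"
proof -
  interpret M: bounded_bilinear "(**) :: complex^2^2 \<Rightarrow> complex^2^2 \<Rightarrow> complex^2^2"
    by (rule bounded_bilinear_matrix_mult)
  \<comment> \<open>The conjugate makes the coefficient matrix only real-linear in q, which suffices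
    to transfer local integrability.\<close>
  define T where "T z = (vector [vector [0, z], vector [- cnj z, 0]] :: complex^2^2)" for z
  have T: "bounded_linear T"
    unfolding linear_conv_bounded_linear[symmetric] T_def
    by (intro linearI) (simp_all add: vec_eq_iff forall_2)
  have coeff: "coeff_mat q = (\<lambda>x. T (q x))" by (simp add: fun_eq_iff coeff_mat_def T_def)
  have C: "coeff_mat q absolutely_integrable_on {a..b}" for a b
    using q absolutely_integrable_linear[OF _ T]
    unfolding L1_loc_def coeff o_def by blast
  obtain K where K: "K \<ge> 0" "\<And>(A :: complex^2^2) (B :: complex^2^2). norm (A ** B) \<le> norm A * norm B * K"
    using M.nonneg_bounded by blast
  obtain U where "AC_loc U" "U 0 = mat 1"
    "AE x in lebesgue. (U has_vector_derivative (coeff_mat q x ** U x)) (at x)"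
  \<comment> \<open>With \<open>K\<close> the bilinear bound of the matrix product, K times the norm
    of the coefficient bounds the right-hand side and is locally integrable.\<close>
  proof (rule linear_ode_solution_exists[of "\<lambda>t u :: complex^2^2. coeff_mat q t ** u" "\<lambda>t. K *\<^sub>R norm (coeff_mat q t)" "mat 1"])
    show "linear (\<lambda>u :: complex^2^2. coeff_mat q t ** u)" for t
      by (rule bounded_linear.linear[OF M.bounded_linear_right])
    show "(\<lambda>t. coeff_mat q t ** u t) absolutely_integrable_on {a..b}" if "continuous_on UNIV u" for u :: "real \<Rightarrow> complex^2^2" and a b
    \<comment> \<open>This rule takes the bounded factor first, hence the flipped product.\<close>
    proof (rule absolutely_integrable_bounded_measurable_product[where h = "\<lambda>A B. B ** A"])
      show "bilinear (\<lambda>(A :: complex^2^2) (B :: complex^2^2). B ** A)"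
        unfolding bilinear_conv_bounded_bilinear by (rule M.flip)
      have c: "continuous_on {a..b} u" using that continuous_on_subset by blast
      then show "u \<in> borel_measurable (lebesgue_on {a..b})"
        by (rule continuous_imp_measurable_on_sets_lebesgue) simp
      show "bounded (u ` {a..b})"
        using c by (intro compact_imp_bounded compact_continuous_image) auto
    qed (use C in auto)
    show "(\<lambda>t. K *\<^sub>R norm (coeff_mat q t)) absolutely_integrable_on {a..b}" for a b
      using absolutely_integrable_norm[OF C] unfolding o_def
      by (intro absolutely_integrable_scaleR_left) auto
    show "0 \<le> K *\<^sub>R norm (coeff_mat q t)" for t using K(1) by simp
    show "norm (coeff_mat q t ** u) \<le> K *\<^sub>R norm (coeff_mat q t) * norm u" for t and u :: "complex^2^2"
      using K(2)[of "coeff_mat q t" u] by (simp add: mult_ac)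
  qed blast
  then show ?thesis unfolding is_Uq_def by blast
qed

section \<open>Conjugation by a fixed fundamental matrix\<close>

context
  fixes q :: "real \<Rightarrow> complex" and U :: "real \<Rightarrow> complex^2^2"
  assumes U: "is_Uq q U"
begin

private lemma AC_U: "AC_loc U"
  and U0: "U 0 = mat 1"
  and U': "AE x in lebesgue. (U has_vector_derivative (coeff_mat q x ** U x)) (at x)"
  using U unfolding is_Uq_def by auto

text \<open>The coefficient matrix is skew-Hermitian, so \<open>U\<^sup>* U\<close> has derivative zero.\<close>
lemma is_Uq_unitary: "unitary_mat (U x)"
proof -
  let ?V = "\<lambda>t. adjoint_mat (U t) ** U t"
  have "AC_loc ?V"
    by (intro AC_loc_bilinear[OF bounded_bilinear_matrix_mult] AC_U
        AC_loc_linear[OF bounded_linear_adjoint_mat])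
  moreover have "AE t in lebesgue. (?V has_vector_derivative 0) (at t)"
    using U'
  proof eventually_elim
    case (elim t)
    have "(?V has_vector_derivative adjoint_mat (U t) ** (coeff_mat q t ** U t) +
        adjoint_mat (coeff_mat q t ** U t) ** U t) (at t)"
      by (intro bounded_bilinear.has_vector_derivative[OF bounded_bilinear_matrix_mult]
          bounded_linear.has_vector_derivative[OF bounded_linear_adjoint_mat] elim)
    moreover have "adjoint_mat (U t) ** (coeff_mat q t ** U t) + adjoint_mat (coeff_mat q t ** U t) ** U t = 0"
      by (simp add: vec_eq_iff forall_2 matrix_matrix_mult_def sum_2 adjoint_mat_def coeff_mat_def algebra_simps)
    ultimately show ?case by simp
  qed
  ultimately have "?V x = ?V 0"
    by (rule AC_loc_zero_derivative_imp_constant)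
  also have "\<dots> = mat 1"
  proof -
    have "adjoint_mat (mat 1) = mat 1"
      by (simp add: vec_eq_iff adjoint_mat_def mat_def)
    then show ?thesis by (simp add: U0)
  qed
  finally show ?thesis
    \<comment> \<open>Constancy yields the adjoint as a left inverse; for square matrices it is then
      also a right inverse.\<close>
    unfolding unitary_mat_def using matrix_left_right_inverse by blast
qed

private abbreviation W :: "real \<Rightarrow> complex^2^2" where "W x \<equiv> adjoint_mat (U x)"

private lemma AC_W: "AC_loc W"
  by (rule AC_loc_linear[OF bounded_linear_adjoint_mat AC_U])

private lemma WU: "W x *v (U x *v v) = v" and UW: "U x *v (W x *v v) = v"
  using unitary_mat_adjoint[OF is_Uq_unitary] by auto

private lemma AC_mult: "AC_loc V \<Longrightarrow> AC_loc F \<Longrightarrow> AC_loc (\<lambda>x. V x *v F x)"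
  for V :: "real \<Rightarrow> complex^2^2"
  by (rule AC_loc_bilinear[OF bounded_bilinear_matrix_vector_mult])

private lemma mult_smult: "A *v (c *s v) = c *s (A *v v)" for A :: "complex^2^2"
  by (simp add: vec_eq_iff matrix_vector_mult_def sum_2 algebra_simps)

lemma is_Uq_entry: "AC_loc (\<lambda>x. U x $ i $ j)" "Linf (\<lambda>x. U x $ i $ j)"
proof -
  show ac: "AC_loc (\<lambda>x. U x $ i $ j)"
    by (intro AC_loc_linear[OF bounded_linear_compose[OF bounded_linear_vec_nth bounded_linear_vec_nth], OF AC_U])
  have "(\<lambda>x. U x $ i $ j) \<in> borel_measurable lebesgue"
    by (intro measurable_completion) (simp add: borel_measurable_continuous_onI AC_loc_imp_continuous_on ac)
  then show "Linf (\<lambda>x. U x $ i $ j)"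
    unfolding Linf_def using norm_unitary_entry_le[OF is_Uq_unitary] by (intro conjI exI[of _ 1]) auto
qed

lemma is_Uq_Nexp:
  assumes F: "AC_loc F"
  shows "AE x in lebesgue. Nexp q (\<lambda>t. U t *v F t) x = U x *v iD F x"
  using U' AC_loc_AE_differentiable[OF F]
proof eventually_elim
  case (elim x)
  from Nexp_eq[OF bounded_bilinear.has_vector_derivative[OF bounded_bilinear_matrix_vector_mult elim]]
  show ?case
    by (simp add: iD_def mult_smult matrix_vector_mul_assoc)
qed

private lemma L2_mult_aux:
  assumes V: "AC_loc V" "\<And>x. unitary_mat (V x)" and F: "L2 F"
  shows "L2 (\<lambda>x. V x *v F x)"
proof -
  have "V \<in> borel_measurable lebesgue"
    by (intro measurable_completion) (simp add: borel_measurable_continuous_onI AC_loc_imp_continuous_on V)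
  moreover have "continuous_on UNIV (\<lambda>x :: (complex^2^2) \<times> (complex^2). fst x *v snd x)"
    by (intro bounded_bilinear.continuous_on[OF bounded_bilinear_matrix_vector_mult] continuous_intros)
  ultimately have "(\<lambda>x. V x *v F x) \<in> borel_measurable lebesgue"
    using F unfolding L2_def by (intro borel_measurable_continuous_Pair[where H = "(*v)"]) auto
  then show ?thesis
    using F by (simp add: L2_def norm_unitary_mult[OF V(2)])
qed

text \<open>The converse is the forward direction for \<open>W\<close>, which is again unitary and
  absolutely continuous.\<close>

private lemma L2_mult_iff: "L2 (\<lambda>x. U x *v F x) \<longleftrightarrow> L2 F"
  using L2_mult_aux[OF AC_U is_Uq_unitary, of F]
    L2_mult_aux[OF AC_W unitary_mat_adjoint(1)[OF is_Uq_unitary], of "\<lambda>x. U x *v F x"]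
  by (auto simp: WU)

lemma conj_mult_Dtilde_max: "conj_mult U (Dtilde_max q) = maxop iD"
proof (intro equalityI subrelI)
  fix F G assume "(F, G) \<in> conj_mult U (Dtilde_max q)"
  then obtain F0 where L2: "L2 F" "L2 G" and F0: "AC_loc F0" "AE x in lebesgue. F0 x = U x *v F x"
    "AE x in lebesgue. U x *v G x = Nexp q F0 x"
    unfolding conj_mult_def Dtilde_max_def maxop_def by (auto simp: L2_mult_iff)
  \<comment> \<open>\<open>F\<close> itself need not be absolutely continuous; multiplying the given
    representative of U F by \<open>W\<close> produces one of \<open>F\<close>.\<close>
  let ?\<Phi> = "\<lambda>x. W x *v F0 x"
  have ac: "AC_loc ?\<Phi>" by (rule AC_mult[OF AC_W F0(1)])
  moreover have "AE x in lebesgue. ?\<Phi> x = F x" using F0(2) by eventually_elim (simp add: WU)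
  moreover have "AE x in lebesgue. G x = iD ?\<Phi> x"
    using F0(3) is_Uq_Nexp[OF ac]
  proof eventually_elim
    case (elim x)
    then have "U x *v G x = U x *v iD ?\<Phi> x" by (simp add: UW)
    then show ?case by (metis WU)
  qed
  ultimately show "(F, G) \<in> maxop iD" using L2 unfolding maxop_def by blast
next
  fix F G assume "(F, G) \<in> maxop iD"
  then obtain F0 where L2: "L2 F" "L2 G" and F0: "AC_loc F0" "AE x in lebesgue. F0 x = F x"
    "AE x in lebesgue. G x = iD F0 x"
    unfolding maxop_def by auto
  have "AE x in lebesgue. U x *v F0 x = U x *v F x" using F0(2) by eventually_elim simp
  moreover have "AE x in lebesgue. U x *v G x = Nexp q (\<lambda>x. U x *v F0 x) x"
    using F0(3) is_Uq_Nexp[OF F0(1)] by eventually_elim simp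
  ultimately show "(F, G) \<in> conj_mult U (Dtilde_max q)"
    using L2 AC_mult[OF AC_U F0(1)] unfolding conj_mult_def Dtilde_max_def maxop_def
    by (auto simp: L2_mult_iff)
qed

private lemma AE_iD_smult:
  assumes "AC_loc \<Psi>"
  shows "AE x in lebesgue. iD (\<lambda>t. \<i> *s \<Psi> t) x = - vd \<Psi> x"
  using AC_loc_AE_differentiable[OF assms]
proof eventually_elim
  case (elim x)
  have "vd (\<lambda>t. \<i> *s \<Psi> t) x = \<i> *s vd \<Psi> x"
    by (rule vd_eqI[OF bounded_linear.has_vector_derivative[OF bounded_linear_vector_smult elim]])
  then show ?case by (simp add: iD_def vector_smult_assoc vec_eq_iff)
qed

lemma conj_mult_Dmax_product:
  "conj_mult U (op_prod (Dmax (\<lambda>t. - q t)) (Dmax q)) = maxop_neg_dd"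
proof (intro equalityI subrelI)
  fix F H assume "(F, H) \<in> conj_mult U (op_prod (Dmax (\<lambda>t. - q t)) (Dmax q))"
  then obtain G F0 G0 where L2: "L2 F" "L2 H"
    and F0: "AC_loc F0" "AE x in lebesgue. F0 x = U x *v F x" "AE x in lebesgue. G x = Mexp q F0 x"
    and G0: "AC_loc G0" "AE x in lebesgue. G0 x = G x"
      "AE x in lebesgue. U x *v H x = Mexp (\<lambda>t. - q t) G0 x"
    unfolding conj_mult_def op_prod_def Dmax_def maxop_def by (auto simp: L2_mult_iff)
  let ?\<Phi> = "\<lambda>x. W x *v F0 x"
  let ?K = "\<lambda>x. negate_snd (G0 x)"
  \<comment> \<open>Solved from K = U (i \<Psi>). As the reflection of \<open>G0\<close>, K equals
    N(q) applied to F0 = U \<Phi>, that is U (i \<Phi>'), a.e.; so \<Psi> is an absolutely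
    continuous representative of \<Phi>'.\<close>
  define \<Psi> where "\<Psi> x = (- \<i>) *s (W x *v ?K x)" for x
  have \<Phi>: "AC_loc ?\<Phi>" by (rule AC_mult[OF AC_W F0(1)])
  have K: "AC_loc ?K" by (rule AC_loc_linear[OF bounded_linear_negate_snd G0(1)])
  have \<Psi>: "AC_loc \<Psi>" unfolding \<Psi>_def[abs_def]
    by (intro AC_loc_linear[OF bounded_linear_vector_smult] AC_mult AC_W K)
  have i\<Psi>: "AC_loc (\<lambda>t. \<i> *s \<Psi> t)" by (rule AC_loc_linear[OF bounded_linear_vector_smult \<Psi>])
  have K_eq: "?K = (\<lambda>x. U x *v (\<i> *s \<Psi> x))"
    by (simp add: \<Psi>_def vector_smult_assoc UW)
  have "AE x in lebesgue. ?\<Phi> x = F x" using F0(2) by eventually_elim (simp add: WU)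
  moreover have "AE x in lebesgue. vd ?\<Phi> x = \<Psi> x"
    using F0(3) G0(2) is_Uq_Nexp[OF \<Phi>]
  proof eventually_elim
    case (elim x)
    then have "?K x = U x *v iD ?\<Phi> x" by (simp add: Mexp_eq_negate_snd_Nexp UW)
    then have "\<Psi> x = (- \<i>) *s iD ?\<Phi> x" by (simp add: \<Psi>_def WU)
    then show ?case by (simp add: iD_def vector_smult_assoc)
  qed
  moreover have "AE x in lebesgue. H x = - vd \<Psi> x"
    using G0(3) AE_Mexp_uminus_negate_snd[OF K, of q] is_Uq_Nexp[OF i\<Psi>] AE_iD_smult[OF \<Psi>]
  proof eventually_elim
    case (elim x)
    then have "U x *v H x = U x *v (- vd \<Psi> x)"
      unfolding K_eq[symmetric] by simp
    then show ?case by (metis WU)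
  qed
  ultimately show "(F, H) \<in> maxop_neg_dd"
    using L2 \<Phi> \<Psi> unfolding maxop_neg_dd_def by blast
next
  fix F H assume "(F, H) \<in> maxop_neg_dd"
  then obtain \<Phi> \<Psi> where L2: "L2 F" "L2 H" and \<Phi>: "AC_loc \<Phi>" and \<Psi>: "AC_loc \<Psi>"
    and ae: "AE x in lebesgue. \<Phi> x = F x" "AE x in lebesgue. vd \<Phi> x = \<Psi> x"
      "AE x in lebesgue. H x = - vd \<Psi> x"
    unfolding maxop_neg_dd_def by auto
  have "L2 \<Psi>"
  proof (rule L2_intermediate_derivative[OF \<Phi> \<Psi>])
    show "AE x in lebesgue. (\<Phi> has_vector_derivative \<Psi> x) (at x)"
      using AC_loc_AE_differentiable[OF \<Phi>] ae(2) by eventually_elim simp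
    show "AE x in lebesgue. (\<Psi> has_vector_derivative vd \<Psi> x) (at x)"
      by (rule AC_loc_AE_differentiable[OF \<Psi>])
    show "L2 \<Phi>" using ae(1) by (intro L2_cong_AE[OF L2(1)]) (auto elim: eventually_mono)
    have "L2 (\<lambda>x. - H x)"
      using L2(2) by (intro L2_isometry[OF bounded_linear_minus[OF bounded_linear_ident]]) auto
    then show "L2 (vd \<Psi>)" using ae(3) by (rule L2_cong_AE[OF _ eventually_mono]) simp
  qed
  have i\<Psi>: "AC_loc (\<lambda>t. \<i> *s \<Psi> t)" by (rule AC_loc_linear[OF bounded_linear_vector_smult \<Psi>])
  \<comment> \<open>The absolutely continuous version of N(q)(U \<Phi>). Its reflection represents
    M(q)(U \<Phi>) and is the function fed to the second factor.\<close>
  define K where "K x = U x *v (\<i> *s \<Psi> x)" for x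
  have K: "AC_loc K" unfolding K_def[abs_def] by (rule AC_mult[OF AC_U i\<Psi>])
  let ?G = "\<lambda>x. negate_snd (K x)"
  have L2G: "L2 ?G" unfolding K_def
    by (intro L2_isometry[OF bounded_linear_negate_snd] L2_mult_iff[THEN iffD2]
        L2_isometry[OF bounded_linear_vector_smult] \<open>L2 \<Psi>\<close>) (simp_all add: norm_vector_smult)
  have acG: "AC_loc ?G" by (rule AC_loc_linear[OF bounded_linear_negate_snd K])
  have U\<Phi>: "AE x in lebesgue. U x *v \<Phi> x = U x *v F x"
    using ae(1) by eventually_elim simp
  have G: "AE x in lebesgue. ?G x = Mexp q (\<lambda>x. U x *v \<Phi> x) x"
    using ae(2) is_Uq_Nexp[OF \<Phi>]
    by eventually_elim (simp add: Mexp_eq_negate_snd_Nexp iD_def K_def)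
  have UH: "AE x in lebesgue. U x *v H x = Mexp (\<lambda>t. - q t) ?G x"
    using ae(3) AE_Mexp_uminus_negate_snd[OF K, of q] is_Uq_Nexp[OF i\<Psi>] AE_iD_smult[OF \<Psi>]
    by eventually_elim (simp add: K_def[abs_def])
  have "((\<lambda>x. U x *v F x), ?G) \<in> Dmax q"
    using L2(1) L2G AC_mult[OF AC_U \<Phi>] U\<Phi> G unfolding Dmax_def maxop_def L2_mult_iff[of F, symmetric]
    by blast
  moreover have "(?G, (\<lambda>x. U x *v H x)) \<in> Dmax (\<lambda>t. - q t)"
  proof -
    have "AE x in lebesgue. ?G x = ?G x" by simp
    then show ?thesis
      using L2(2) L2G acG UH unfolding Dmax_def maxop_def L2_mult_iff[of H, symmetric] by blast
  qed
  ultimately show "(F, H) \<in> conj_mult U (op_prod (Dmax (\<lambda>t. - q t)) (Dmax q))"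
    unfolding conj_mult_def op_prod_def by blast
qed

end

section \<open>Domains of the two constant-coefficient operators\<close>

lemma dom_maxop_iD: "dom_op (maxop iD) = H12"
proof (intro equalityI subsetI)
  fix F assume "F \<in> dom_op (maxop iD)"
  then obtain G F0 where *: "L2 F" "L2 G" "AC_loc F0" "AE x in lebesgue. F0 x = F x"
    "AE x in lebesgue. G x = iD F0 x"
    unfolding dom_op_def maxop_def by auto
  have "L2 (\<lambda>x. (- \<i>) *s G x)"
    using *(2) by (intro L2_isometry[OF bounded_linear_vector_smult]) (simp_all add: norm_vector_smult)
  moreover have "AE x in lebesgue. (- \<i>) *s G x = vd F0 x"
    using *(5) by eventually_elim (simp add: iD_def vector_smult_assoc)
  ultimately have "L2 (vd F0)" by (rule L2_cong_AE)
  then show "F \<in> H12" using * unfolding H12_def by blast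
next
  fix F assume "F \<in> H12"
  then obtain F0 where *: "L2 F" "AC_loc F0" "AE x in lebesgue. F0 x = F x" "L2 (vd F0)"
    unfolding H12_def by auto
  have "L2 (iD F0)" unfolding iD_def[abs_def]
    using *(4) by (intro L2_isometry[OF bounded_linear_vector_smult]) (simp_all add: norm_vector_smult)
  with * have "(F, iD F0) \<in> maxop iD" unfolding maxop_def by auto
  then show "F \<in> dom_op (maxop iD)" unfolding dom_op_def by force
qed

text \<open>\<open>maxop_neg_dd\<close> puts the function and its second derivative in L2, whereas
  \<open>H22\<close> also lists the first; the forward inclusion therefore rests on
  \<open>L2_intermediate_derivative\<close>.\<close>

lemma dom_maxop_neg_dd: "dom_op maxop_neg_dd = H22"
proof (intro equalityI subsetI)
  fix F assume "F \<in> dom_op maxop_neg_dd"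
  then obtain H F0 F1 where *: "L2 F" "L2 H" "AC_loc F0" "AC_loc F1" "AE x in lebesgue. F0 x = F x"
    "AE x in lebesgue. vd F0 x = F1 x" "AE x in lebesgue. H x = - vd F1 x"
    unfolding dom_op_def maxop_neg_dd_def by auto
  have "L2 (\<lambda>x. - H x)"
    using *(2) by (intro L2_isometry[OF bounded_linear_minus[OF bounded_linear_ident]]) auto
  then have L2_F1': "L2 (vd F1)" using *(7) by (rule L2_cong_AE[OF _ eventually_mono]) simp
  have "L2 F1"
  proof (rule L2_intermediate_derivative[OF *(3,4)])
    show "AE x in lebesgue. (F0 has_vector_derivative F1 x) (at x)"
      using AC_loc_AE_differentiable[OF *(3)] *(6) by eventually_elim simp
    show "AE x in lebesgue. (F1 has_vector_derivative vd F1 x) (at x)"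
      by (rule AC_loc_AE_differentiable[OF *(4)])
    show "L2 F0" using *(5) by (intro L2_cong_AE[OF *(1)]) (auto elim: eventually_mono)
  qed (rule L2_F1')
  then show "F \<in> H22" using * L2_F1' unfolding H22_def by blast
next
  fix F assume "F \<in> H22"
  then obtain F0 F1 where *: "L2 F" "AC_loc F0" "AC_loc F1" "AE x in lebesgue. F0 x = F x"
    "AE x in lebesgue. vd F0 x = F1 x" "L2 (vd F1)"
    unfolding H22_def by auto
  have "L2 (\<lambda>x. - vd F1 x)"
    using *(6) by (intro L2_isometry[OF bounded_linear_minus[OF bounded_linear_ident]]) auto
  with * have "(F, \<lambda>x. - vd F1 x) \<in> maxop_neg_dd" unfolding maxop_neg_dd_def by auto
  then show "F \<in> dom_op maxop_neg_dd" unfolding dom_op_def by force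
qed

text \<open>A second expression can be applied once the first result has an absolutely continuous
  representative. M(q)F and N(q)F differ by the reflection, so one has such a representative exactly
  when the other does.\<close>

lemma Mexp_uminus_Mexp:
  assumes F: "AC_loc F"
  shows "(\<exists>G. AC_loc G \<and> (AE x in lebesgue. G x = Mexp q F x)) \<longleftrightarrow>
         (\<exists>H. AC_loc H \<and> (AE x in lebesgue. H x = Nexp q F x))" (is ?A)
    and "AC_loc G \<and> (AE x in lebesgue. G x = Mexp q F x) \<and>
         AC_loc H \<and> (AE x in lebesgue. H x = Nexp q F x) \<Longrightarrow>
         AE x in lebesgue. Mexp (\<lambda>t. - q t) G x = Nexp q H x"
proof -
  have ac: "AC_loc (\<lambda>x. negate_snd (G x))" if "AC_loc G" for G
    by (rule AC_loc_linear[OF bounded_linear_negate_snd that])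
  show ?A
  proof
    assume "\<exists>G. AC_loc G \<and> (AE x in lebesgue. G x = Mexp q F x)"
    then obtain G where G: "AC_loc G" "AE x in lebesgue. G x = Mexp q F x" by blast
    have "AE x in lebesgue. negate_snd (G x) = Nexp q F x"
      using G(2) by eventually_elim (simp add: Mexp_eq_negate_snd_Nexp)
    with ac[OF G(1)] show "\<exists>H. AC_loc H \<and> (AE x in lebesgue. H x = Nexp q F x)" by blast
  next
    assume "\<exists>H. AC_loc H \<and> (AE x in lebesgue. H x = Nexp q F x)"
    then obtain H where H: "AC_loc H" "AE x in lebesgue. H x = Nexp q F x" by blast
    have "AE x in lebesgue. negate_snd (H x) = Mexp q F x"
      using H(2) by eventually_elim (simp add: Mexp_eq_negate_snd_Nexp)
    with ac[OF H(1)] show "\<exists>G. AC_loc G \<and> (AE x in lebesgue. G x = Mexp q F x)" by blast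
  qed
  assume "AC_loc G \<and> (AE x in lebesgue. G x = Mexp q F x) \<and>
    AC_loc H \<and> (AE x in lebesgue. H x = Nexp q F x)"
  then have GH: "AC_loc G" "AE x in lebesgue. G x = Mexp q F x"
    "AC_loc H" "AE x in lebesgue. H x = Nexp q F x" by auto
  have "AE x in lebesgue. G x = negate_snd (H x)"
    using GH(2,4) by eventually_elim (simp add: Mexp_eq_negate_snd_Nexp)
  \<comment> \<open>Equality a.e. does not determine pointwise derivatives, so continuity is used to
    obtain equality everywhere first.\<close>
  then have "G = (\<lambda>x. negate_snd (H x))"
    using GH(1) ac[OF GH(3)] by (intro continuous_AE_eq_imp_eq AC_loc_imp_continuous_on)
  then show "AE x in lebesgue. Mexp (\<lambda>t. - q t) G x = Nexp q H x"
    using AE_Mexp_uminus_negate_snd[OF GH(3)] by simp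
qed

theorem theorem3p3:
  fixes q :: "real \<Rightarrow> complex"
  assumes q: "L1_loc q"
  shows
    \<comment> \<open>(i) M(-q) M(q) = N(q)^2 as differential expressions\<close>
    "(\<forall>F. AC_loc F \<longrightarrow>
        ((\<exists>G. AC_loc G \<and> (AE x in lebesgue. G x = Mexp q F x)) \<longleftrightarrow>
         (\<exists>H. AC_loc H \<and> (AE x in lebesgue. H x = Nexp q F x))) \<and>
        (\<forall>G H. AC_loc G \<and> (AE x in lebesgue. G x = Mexp q F x) \<and>
               AC_loc H \<and> (AE x in lebesgue. H x = Nexp q F x) \<longrightarrow>
               (AE x in lebesgue. Mexp (\<lambda>t. - q t) G x = Nexp q H x)))
     \<and> (\<exists>U. is_Uq q U)
     \<and> (\<forall>U. is_Uq q U \<longrightarrow>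
        \<comment> \<open>(ii)\<close>
          (\<forall>x. unitary_mat (U x))
        \<and> (\<forall>i j. AC_loc (\<lambda>x. U x $ i $ j) \<and> Linf (\<lambda>x. U x $ i $ j))
        \<and> (\<forall>F. AC_loc F \<longrightarrow>
             (AE x in lebesgue. matrix_inv (U x) *v Nexp q (\<lambda>t. U t *v F t) x = iD F x))
        \<comment> \<open>(iii)\<close>
        \<and> conj_mult U (Dtilde_max q) = maxop iD
        \<and> dom_op (maxop iD) = H12
        \<and> conj_mult U (op_prod (Dmax (\<lambda>t. - q t)) (Dmax q)) = maxop_neg_dd
        \<and> dom_op maxop_neg_dd = H22)"
proof (intro conjI allI impI)
  fix U :: "real \<Rightarrow> complex^2^2" and F :: "real \<Rightarrow> complex^2"
  assume U: "is_Uq q U" and F: "AC_loc F"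
  show "AE x in lebesgue. matrix_inv (U x) *v Nexp q (\<lambda>t. U t *v F t) x = iD F x"
    using is_Uq_Nexp[OF U F]
  proof eventually_elim
    case (elim x)
    then show ?case
      using unitary_mat_adjoint(2)[OF is_Uq_unitary[OF U]] by (simp add: matrix_inv_unitary[OF is_Uq_unitary[OF U]])
  qed
qed (rule Mexp_uminus_Mexp is_Uq_exists[OF q] is_Uq_unitary is_Uq_entry conj_mult_Dtilde_max
    dom_maxop_iD conj_mult_Dmax_product dom_maxop_neg_dd; assumption)+

end
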